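(* Let $n\ge 1$ and let $F:\mathbb{R}^n\to\mathbb{R}^n$ be a vector field of class $\mathcal{C}^1$ such that $\dot x=F(x)$ defines a global flow $x(t;x_0,t_0)$. Let $G:\mathbb{R}^{n+1}\to\mathbb{R}$, $(x,t)\mapsto G(x,t)$, be of class $\mathcal{C}^1$, and let $S=\{(x,t)\in\mathbb{R}^{n+1} : G(x,t)=0\}$. Let $\hat t_S$ and $\hat x_S$ be the first hitting time and hitting state of $S$, let $$\hat S=\left\{(x,t)\in S : \frac{\partial G}{\partial t}(x,t)+\langle D_xG(x,t),F(x)\rangle\neq 0\right\},$$ and define $$\mathcal{R}_S^T=\left\{(x_0,t_0)\in\mathbb{R}^{n+1} : (x_0,t_0)\notin S,\ \hat t_S(x_0,t_0)<+\infty,\ (\hat x_S(x_0,t_0),\hat t_S(x_0,t_0))\in\hat S\right\}.$$ Then $\mathcal{R}_S^T$ is open, and $\hat t_S$ and $\hat x_S$ are differentiable on $\mathcal{R}_S^T$. Moreover, for all $(x_0,t_0)\in\mathcal{R}_S^T$, $$\frac{\partial \hat t_S}{\partial t_0}(x_0,t_0)+\langle D_{x_0}\hat t_S(x_0,t_0),F(x_0)\rangle=0,$$ $$\frac{\partial \hat x_S}{\partial t_0}(x_0,t_0)+D_{x_0}\hat x_S(x_0,t_0)\,F(x_0)=0.$$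
   Context: For $(x_0,t_0)\in\mathbb{R}^n\times\mathbb{R}$, $x(t;x_0,t_0)\in\mathbb{R}^n$ denotes the value at time $t$ of the unique solution of $\dot x=F(x)$ with $x(t_0)=x_0$. The flow is called global if, for every $(x_0,t_0)\in\mathbb{R}^n\times\mathbb{R}$, this solution is defined for all $t\in\mathbb{R}$. For a closed set $S\subseteq\mathbb{R}^{n+1}$, the first hitting time of $S$ starting from $(x_0,t_0)$ is $$\hat t_S(x_0,t_0):=\inf\{t>t_0 : (x(t;x_0,t_0),t)\in S\}\in\mathbb{R}\cup\{+\infty\},$$ with the convention $\inf\emptyset=+\infty$. $S$ is said to be reachable from $(x_0,t_0)$ if $\hat t_S(x_0,t_0)<+\infty$; in that case the hitting state is $\hat x_S(x_0,t_0):=x(\hat t_S(x_0,t_0);x_0,t_0)\in\mathbb{R}^n$. $\langle\cdot,\cdot\rangle$ is the standard inner product of $\mathbb{R}^n$; $D_xG$ is the gradient of $G$ with respect to $x\in\mathbb{R}^n$; $D_{x_0}\hat t_S$ is the gradient of $\hat t_S$ with respect to $x_0$, and $D_{x_0}\hat x_S$ is the $n\times n$ Jacobian matrix of $\hat x_S$ with respect to $x_0$. *)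

theory Defs
  imports "HOL-Analysis.Analysis"
begin

text \<open>
  The space \<open>\<real>\<^sup>n \<times> \<real>\<close> of pairs \<open>(x, t)\<close>, with \<open>\<real>\<^sup>n\<close> rendered as
  \<^typ>\<open>real ^ 'n\<close>, plays the role of \<open>\<real>\<^bsup>n+1\<^esup>\<close>.
\<close>

definition C1_map :: "('a::real_normed_vector \<Rightarrow> 'b::real_normed_vector) \<Rightarrow> bool" where
  "C1_map f \<longleftrightarrow>
     (\<exists>f' :: 'a \<Rightarrow> ('a \<Rightarrow>\<^sub>L 'b).
        (\<forall>x. (f has_derivative blinfun_apply (f' x)) (at x)) \<and> continuous_on UNIV f')"

definition gradient :: "('a::real_inner \<Rightarrow> real) \<Rightarrow> 'a \<Rightarrow> 'a" where
  "gradient f x = (THE D. GDERIV f x :> D)"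

definition global_solution ::
  "(real ^ 'n \<Rightarrow> real ^ 'n) \<Rightarrow> real ^ 'n \<Rightarrow> real \<Rightarrow> (real \<Rightarrow> real ^ 'n) \<Rightarrow> bool" where
  "global_solution F x\<^sub>0 t\<^sub>0 x \<longleftrightarrow>
     x t\<^sub>0 = x\<^sub>0 \<and> (\<forall>t. (x has_vector_derivative F (x t)) (at t))"

text \<open>
  Only existence is demanded here: for a \<open>C\<^sup>1\<close> field, uniqueness is a theorem, and a solution
  defined on all of \<open>\<real>\<close> is then the maximal one.
\<close>

definition global_flow :: "(real ^ 'n \<Rightarrow> real ^ 'n) \<Rightarrow> bool" where
  "global_flow F \<longleftrightarrow> (\<forall>x\<^sub>0 t\<^sub>0. \<exists>x. global_solution F x\<^sub>0 t\<^sub>0 x)"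

text \<open>\<open>flow F t x\<^sub>0 t\<^sub>0\<close> stands for \<open>x(t; x\<^sub>0, t\<^sub>0)\<close>.\<close>

definition flow :: "(real ^ 'n \<Rightarrow> real ^ 'n) \<Rightarrow> real \<Rightarrow> real ^ 'n \<Rightarrow> real \<Rightarrow> real ^ 'n" where
  "flow F t x\<^sub>0 t\<^sub>0 = (THE x. global_solution F x\<^sub>0 t\<^sub>0 x) t"

text \<open>In \<^typ>\<open>ereal\<close>, the infimum of the empty set is \<open>\<infinity>\<close>.\<close>

definition hit_time ::
  "(real ^ 'n \<Rightarrow> real ^ 'n) \<Rightarrow> ((real ^ 'n) \<times> real) set \<Rightarrow> real ^ 'n \<Rightarrow> real \<Rightarrow> ereal" where
  "hit_time F S x\<^sub>0 t\<^sub>0 = Inf (ereal ` {t. t > t\<^sub>0 \<and> (flow F t x\<^sub>0 t\<^sub>0, t) \<in> S})"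

text \<open>
  The finite hitting time as a real number, and the hitting state. Both carry meaning only where
  \<open>hit_time F S x\<^sub>0 t\<^sub>0 < \<infinity>\<close> (it is never \<open>-\<infinity>\<close>, being at least \<open>t\<^sub>0\<close>).
\<close>

definition hit_time_real ::
  "(real ^ 'n \<Rightarrow> real ^ 'n) \<Rightarrow> ((real ^ 'n) \<times> real) set \<Rightarrow> real ^ 'n \<Rightarrow> real \<Rightarrow> real" where
  "hit_time_real F S x\<^sub>0 t\<^sub>0 = real_of_ereal (hit_time F S x\<^sub>0 t\<^sub>0)"

definition hit_state ::
  "(real ^ 'n \<Rightarrow> real ^ 'n) \<Rightarrow> ((real ^ 'n) \<times> real) set \<Rightarrow> real ^ 'n \<Rightarrow> real \<Rightarrow> real ^ 'n" where
  "hit_state F S x\<^sub>0 t\<^sub>0 = flow F (hit_time_real F S x\<^sub>0 t\<^sub>0) x\<^sub>0 t\<^sub>0"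

definition zero_set :: "((real ^ 'n) \<times> real \<Rightarrow> real) \<Rightarrow> ((real ^ 'n) \<times> real) set" where
  "zero_set G = {(x, t). G (x, t) = 0}"

definition transversal_part ::
  "(real ^ 'n \<Rightarrow> real ^ 'n) \<Rightarrow> ((real ^ 'n) \<times> real \<Rightarrow> real) \<Rightarrow> ((real ^ 'n) \<times> real) set" where
  "transversal_part F G =
     {(x, t). (x, t) \<in> zero_set G \<and>
        deriv (\<lambda>s. G (x, s)) t + gradient (\<lambda>y. G (y, t)) x \<bullet> F x \<noteq> 0}"

definition transversal_reach_set ::
  "(real ^ 'n \<Rightarrow> real ^ 'n) \<Rightarrow> ((real ^ 'n) \<times> real \<Rightarrow> real) \<Rightarrow> ((real ^ 'n) \<times> real) set" where
  "transversal_reach_set F G =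
     {(x\<^sub>0, t\<^sub>0). (x\<^sub>0, t\<^sub>0) \<notin> zero_set G \<and>
        hit_time F (zero_set G) x\<^sub>0 t\<^sub>0 < \<infinity> \<and>
        (hit_state F (zero_set G) x\<^sub>0 t\<^sub>0, hit_time_real F (zero_set G) x\<^sub>0 t\<^sub>0)
          \<in> transversal_part F G}"

end

theory Submission
  imports Defs
begin

text \<open>
  Write \<open>H((x\<^sub>0, t\<^sub>0), t) = G(x(t; x\<^sub>0, t\<^sub>0), t)\<close>, so that the hitting time \<open>\<tau>\<close> is the first zero
  of \<open>H\<close> after \<open>t\<^sub>0\<close> and transversality says \<open>\<partial>H/\<partial>t \<noteq> 0\<close> there. Near such a point \<open>H\<close> changes sign, so
  a zero persists under perturbation, and by compactness no earlier zero can appear; hence \<open>\<tau>\<close> is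
  continuous, and it is differentiable because \<open>H\<close> is. Along a trajectory
  \<open>s \<mapsto> (x(t\<^sub>0 + s; x\<^sub>0, t\<^sub>0), t\<^sub>0 + s)\<close> neither \<open>H\<close> nor the state at time \<open>t\<close> changes, so both have
  derivative zero in the direction \<open>((F x\<^sub>0, 1), 0)\<close>; this gives the two transport equations.
\<close>

section \<open>Gronwall's inequality\<close>

text \<open>\<open>F\<close> is Lipschitz only on bounded sets, and a neighbouring trajectory is not
  known in advance to stay in one. Gronwall's inequality therefore takes a form whose hypothesis is
  required only while the difference is small. Two choices keep the rest elementary. The state
  derivative of the flow is obtained pointwise, and joint differentiability then comes from
  continuity of the time derivative. The first zero is shown to be continuous before it is
  differentiated, so its derivative uses differentiability of \<open>H\<close> at a single point.
  The identity behind both transport equations is \<open>L (F x) = F (\<phi> x t)\<close>: the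
  derivative of the flow carries the field at the start of a trajectory to the field at its
  end.\<close>

lemma gronwall_nonneg:
  fixes D :: "real \<Rightarrow> 'a::real_inner"
  assumes D: "\<And>s. s \<in> {0..T} \<Longrightarrow> (D has_vector_derivative D' s) (at s)"
    and bound: "\<And>s. s \<in> {0..T} \<Longrightarrow> norm (D' s) \<le> K * norm (D s) + \<eta>"
    and nonneg: "0 \<le> T" "0 \<le> K" "0 \<le> \<eta>"
  shows "norm (D T) \<le> exp ((2 * K + 1) * T) * (norm (D 0) + \<eta>)"
proof -
  \<comment> \<open>The squared norm is differentiable even where \<open>D\<close> vanishes. Its
    growth rate is \<open>2 * K\<close>, and the extra 1 pays for splitting the mixed term
    \<open>2 * (norm (D s) * \<eta>)\<close> into squares.\<close>
  define c where "c = 2 * K + 1"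
  define g where "g s = exp (- c * s) * (D s \<bullet> D s + \<eta>\<^sup>2)" for s
  have "\<exists>y. DERIV g s :> y \<and> y \<le> 0" if "0 \<le> s" "s \<le> T" for s
  proof -
    have Ds: "(D has_derivative (\<lambda>h. h *\<^sub>R D' s)) (at s)"
      using D[of s] that by (simp add: has_vector_derivative_def)
    let ?y = "exp (- c * s) * (2 * (D s \<bullet> D' s) - c * (D s \<bullet> D s + \<eta>\<^sup>2))"
    have "(g has_derivative (\<lambda>h. h * ?y)) (at s)"
      unfolding g_def
      by (rule derivative_eq_intros Ds refl ext | simp)+ (auto simp: algebra_simps inner_commute)
    then have "DERIV g s :> ?y"
      by (simp add: has_field_derivative_def mult_commute_abs)
    moreover have "?y \<le> 0"
    proof -
      have "D s \<bullet> D' s \<le> norm (D s) * norm (D' s)"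
        by (rule norm_cauchy_schwarz)
      also have "\<dots> \<le> norm (D s) * (K * norm (D s) + \<eta>)"
        using bound[of s] that by (intro mult_left_mono) auto
      finally have "2 * (D s \<bullet> D' s) \<le> 2 * K * (norm (D s))\<^sup>2 + 2 * (norm (D s) * \<eta>)"
        by (simp add: algebra_simps power2_eq_square)
      also have "2 * (norm (D s) * \<eta>) \<le> (norm (D s))\<^sup>2 + \<eta>\<^sup>2"
        using sum_squares_bound[of "norm (D s)" \<eta>] by simp
      also have "2 * K * (norm (D s))\<^sup>2 + ((norm (D s))\<^sup>2 + \<eta>\<^sup>2) \<le> c * (D s \<bullet> D s + \<eta>\<^sup>2)"
        using nonneg by (simp add: c_def algebra_simps power2_norm_eq_inner)
      finally show ?thesis
        by (simp add: mult_le_0_iff)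
    qed
    ultimately show ?thesis by blast
  qed
  then have "g T \<le> g 0"
    using DERIV_nonpos_imp_nonincreasing[of 0 T g] nonneg by blast
  then have "exp (- c * T) * ((norm (D T))\<^sup>2 + \<eta>\<^sup>2) \<le> (norm (D 0))\<^sup>2 + \<eta>\<^sup>2"
    by (simp add: g_def power2_norm_eq_inner)
  then have "(norm (D T))\<^sup>2 + \<eta>\<^sup>2 \<le> exp (c * T) * ((norm (D 0))\<^sup>2 + \<eta>\<^sup>2)"
    by (simp add: exp_minus field_simps)
  then have "(norm (D T))\<^sup>2 \<le> exp (c * T) * ((norm (D 0))\<^sup>2 + \<eta>\<^sup>2)"
    using zero_le_power2[of \<eta>] by linarith
  \<comment> \<open>Since the exponential is at least 1, doubling the exponent only weakens the
    bound and makes the right side a perfect square.\<close>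
  also have "\<dots> \<le> (exp (c * T) * exp (c * T)) * (norm (D 0) + \<eta>)\<^sup>2"
  proof (rule mult_mono)
    have "1 \<le> exp (c * T)"
      using nonneg by (simp add: c_def)
    then show "exp (c * T) \<le> exp (c * T) * exp (c * T)"
      by simp
    show "(norm (D 0))\<^sup>2 + \<eta>\<^sup>2 \<le> (norm (D 0) + \<eta>)\<^sup>2"
      using nonneg by (simp add: power2_sum)
  qed auto
  also have "\<dots> = (exp (c * T) * (norm (D 0) + \<eta>))\<^sup>2"
    by (simp add: power2_eq_square)
  finally have "norm (D T) \<le> exp (c * T) * (norm (D 0) + \<eta>)"
    by (rule power2_le_imp_le) (use nonneg in simp)
  then show ?thesis by (simp only: c_def)
qed

text \<open>A continuation argument: up to the first time at which the norm reaches \<open>r\<close>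
  the plain inequality applies, and by \<open>small\<close> it yields a value strictly below
  \<open>r\<close> there. Hence the norm never reaches \<open>r\<close>, and the plain inequality
  holds on the whole interval.\<close>

lemma gronwall_local_nonneg:
  fixes D :: "real \<Rightarrow> 'a::real_inner"
  assumes D: "\<And>s. s \<in> {0..T} \<Longrightarrow> (D has_vector_derivative D' s) (at s)"
    and bound: "\<And>s. s \<in> {0..T} \<Longrightarrow> norm (D s) \<le> r \<Longrightarrow> norm (D' s) \<le> K * norm (D s) + \<eta>"
    and nonneg: "0 \<le> T" "0 \<le> K" "0 \<le> \<eta>"
    and small: "exp ((2 * K + 1) * T) * (norm (D 0) + \<eta>) < r"
  shows "norm (D T) \<le> exp ((2 * K + 1) * T) * (norm (D 0) + \<eta>)"
proof -
  have cont: "continuous_on {0..T} (\<lambda>s. norm (D s))"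
    by (intro continuous_on_norm continuous_at_imp_continuous_on ballI
        has_vector_derivative_continuous[OF D])
  have exp_le: "exp ((2 * K + 1) * s) * (norm (D 0) + \<eta>)
      \<le> exp ((2 * K + 1) * T) * (norm (D 0) + \<eta>)" if "s \<le> T" for s
    using nonneg that by (intro mult_right_mono) (auto intro!: mult_left_mono)
  have le: "norm (D s) \<le> exp ((2 * K + 1) * T) * (norm (D 0) + \<eta>)"
    if "0 \<le> s" "s \<le> T" and below: "\<And>u. u \<in> {0..s} \<Longrightarrow> norm (D u) \<le> r" for s
  proof -
    have "norm (D s) \<le> exp ((2 * K + 1) * s) * (norm (D 0) + \<eta>)"
      using that nonneg by (intro gronwall_nonneg[where D' = D'] D bound) auto
    then show ?thesis using exp_le[OF \<open>s \<le> T\<close>] by simp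
  qed
  define Z where "Z = {s \<in> {0..T}. norm (D s) = r}"
  have "norm (D 0) < r"
  proof -
    have "1 * norm (D 0) \<le> exp ((2 * K + 1) * T) * (norm (D 0) + \<eta>)"
      using nonneg by (intro mult_mono) auto
    then show ?thesis using small by simp
  qed
  have first: "\<exists>u \<in> {0..s}. u \<in> Z" if "s \<in> {0..T}" "r \<le> norm (D s)" for s
    using IVT'[of "\<lambda>s. norm (D s)" 0 r s] that \<open>norm (D 0) < r\<close>
      continuous_on_subset[OF cont, of "{0..s}"]
    by (force simp: Z_def)
  have "Z = {}"
  proof (rule ccontr)
    assume "Z \<noteq> {}"
    moreover have "compact Z"
    proof -
      have "closed Z"
        unfolding Z_def
        using continuous_closed_preimage[OF cont closed_real_atLeastAtMost, of "{r}"]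
        by (simp add: vimage_def Int_def)
      moreover have "bounded Z"
        by (rule bounded_subset[OF bounded_closed_interval[of 0 T]]) (auto simp: Z_def)
      ultimately show ?thesis by (simp add: compact_eq_bounded_closed)
    qed
    ultimately obtain s where s: "s \<in> Z" "\<And>u. u \<in> Z \<Longrightarrow> s \<le> u"
      using compact_attains_inf[of Z] by blast
    \<comment> \<open>A value above \<open>r\<close> at \<open>u\<close> would, by the intermediate
      value theorem, put a point of \<open>Z\<close> in \<open>{0..u}\<close>. Minimality of
      \<open>s\<close> leaves only \<open>u = s\<close>, where the norm equals
      \<open>r\<close>.\<close>
    have "norm (D u) \<le> r" if "u \<in> {0..s}" for u
    proof (rule ccontr)
      assume "\<not> norm (D u) \<le> r"
      moreover have "u \<in> {0..T}" using that s(1) by (auto simp: Z_def)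
      ultimately obtain v where v: "v \<in> {0..u}" "v \<in> Z" using first[of u] by force
      then have "v = u" using s(2)[of v] that by auto
      then show False using v \<open>\<not> norm (D u) \<le> r\<close> by (simp add: Z_def)
    qed
    then have "norm (D s) < r"
      using le[of s] s(1) small by (auto simp: Z_def)
    then show False using s(1) by (simp add: Z_def)
  qed
  then have "norm (D u) \<le> r" if "u \<in> {0..T}" for u
    using first[of u] that by fastforce
  then show ?thesis using le[of T] nonneg by auto
qed

text \<open>Negative times reduce to positive ones by time reversal, which only flips the sign of
  the derivative and so preserves the bound.\<close>

lemma gronwall_local:
  fixes D :: "real \<Rightarrow> 'a::real_inner"
  assumes D: "\<And>s. \<bar>s\<bar> \<le> T \<Longrightarrow> (D has_vector_derivative D' s) (at s)"
    and bound: "\<And>s. \<bar>s\<bar> \<le> T \<Longrightarrow> norm (D s) \<le> r \<Longrightarrow> norm (D' s) \<le> K * norm (D s) + \<eta>"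
    and nonneg: "0 \<le> K" "0 \<le> \<eta>"
    and small: "exp ((2 * K + 1) * T) * (norm (D 0) + \<eta>) < r"
    and t: "\<bar>t\<bar> \<le> T"
  shows "norm (D t) \<le> exp ((2 * K + 1) * T) * (norm (D 0) + \<eta>)"
proof -
  have exp_le: "exp ((2 * K + 1) * \<bar>t\<bar>) * (norm (D 0) + \<eta>)
      \<le> exp ((2 * K + 1) * T) * (norm (D 0) + \<eta>)"
    using nonneg t by (intro mult_right_mono) (auto intro!: mult_left_mono)
  have "norm (D t) \<le> exp ((2 * K + 1) * \<bar>t\<bar>) * (norm (D 0) + \<eta>)"
  proof (cases "0 \<le> t")
    case True
    then show ?thesis
      using gronwall_local_nonneg[of "\<bar>t\<bar>" D D' r K \<eta>] D bound nonneg t small exp_le by fastforce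
  next
    case False
    have "(D \<circ> uminus has_vector_derivative - D' (- s)) (at s)" if "s \<in> {0..\<bar>t\<bar>}" for s
      using vector_diff_chain_at[of uminus "-1" s D "D' (- s)"] D[of "- s"] that t
      has_vector_derivative_minus[OF has_vector_derivative_id, of "at s"]
      by simp
    then have "norm ((D \<circ> uminus) \<bar>t\<bar>)
        \<le> exp ((2 * K + 1) * \<bar>t\<bar>) * (norm ((D \<circ> uminus) 0) + \<eta>)"
    proof (rule gronwall_local_nonneg[where r = r and D' = "\<lambda>s. - D' (- s)"])
      show "norm (- D' (- s)) \<le> K * norm ((D \<circ> uminus) s) + \<eta>"
        if "s \<in> {0..\<bar>t\<bar>}" "norm ((D \<circ> uminus) s) \<le> r" for s
        using bound[of "- s"] that t by simp
      show "exp ((2 * K + 1) * \<bar>t\<bar>) * (norm ((D \<circ> uminus) 0) + \<eta>) < r"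
        using exp_le small by simp
    qed (use nonneg in auto)
    then show ?thesis using False by simp
  qed
  then show ?thesis using exp_le by simp
qed

section \<open>Dependence of the flow on the initial state\<close>

text \<open>One constant serves twice: as a Lipschitz constant of \<open>F\<close> when trajectories
  are compared, and as a bound on \<open>F'\<close> in the linearized equation.\<close>

lemma C1_lipschitz_on_cball:
  fixes F :: "'a::euclidean_space \<Rightarrow> 'b::real_normed_vector"
  assumes der: "\<And>x. (F has_derivative blinfun_apply (F' x)) (at x)"
    and cont: "continuous_on UNIV F'"
  obtains K where "0 \<le> K" "\<And>z. z \<in> cball 0 R \<Longrightarrow> norm (F' z) \<le> K"
    "\<And>z w. z \<in> cball 0 R \<Longrightarrow> w \<in> cball 0 R \<Longrightarrow> norm (F z - F w) \<le> K * norm (z - w)"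
proof -
  have "compact (F' ` cball 0 R)"
    using cont by (intro compact_continuous_image) (auto intro: continuous_on_subset)
  then obtain K where K: "K > 0" "\<And>z. z \<in> cball 0 R \<Longrightarrow> norm (F' z) \<le> K"
    using compact_imp_bounded bounded_pos by (metis imageI)
  show thesis
  proof
    show "norm (F z - F w) \<le> K * norm (z - w)" if "z \<in> cball 0 R" "w \<in> cball 0 R" for z w
    proof (rule differentiable_bound[OF convex_cball[of 0 R] _ _ that])
      show "(F has_derivative blinfun_apply (F' x)) (at x within cball 0 R)" for x
        by (rule has_derivative_at_withinI[OF der])
      show "onorm (blinfun_apply (F' x)) \<le> K" if "x \<in> cball 0 R" for x
        using K(2)[OF that] by (simp add: norm_blinfun.rep_eq)
    qed
  qed (use K in auto)
qed

text \<open>Uniform continuity of \<open>F'\<close> on the compact ball makes \<open>r\<close>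
  independent of the base point \<open>z\<close>, so the linearization can be used along an entire
  trajectory segment at once.\<close>

lemma C1_uniform_linearization:
  fixes F :: "'a::euclidean_space \<Rightarrow> 'b::real_normed_vector"
  assumes der: "\<And>x. (F has_derivative blinfun_apply (F' x)) (at x)"
    and cont: "continuous_on UNIV F'" and "\<epsilon> > 0"
  obtains r where "r > 0" "\<And>z w. z \<in> cball 0 R \<Longrightarrow> w \<in> cball 0 R \<Longrightarrow> dist w z < r \<Longrightarrow>
    norm (F w - F z - F' z (w - z)) \<le> \<epsilon> * norm (w - z)"
proof -
  have "uniformly_continuous_on (cball 0 R) F'"
    using cont by (intro compact_uniformly_continuous) (auto intro: continuous_on_subset)
  then obtain r where r: "r > 0" "\<And>z w. z \<in> cball 0 R \<Longrightarrow> w \<in> cball 0 R \<Longrightarrow> dist w z < r \<Longrightarrow>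
      dist (F' w) (F' z) < \<epsilon>"
    using \<open>\<epsilon> > 0\<close> unfolding uniformly_continuous_on_def by metis
  show thesis
  proof
    fix z w :: 'a assume zw: "z \<in> cball 0 R" "w \<in> cball 0 R" "dist w z < r"
    let ?S = "cball 0 R \<inter> ball z r"
    have "norm (F w - F z - F' z (w - z)) \<le> norm (w - z) * \<epsilon>"
    proof (rule differentiable_bound_linearization[where S = ?S and f' = "\<lambda>x. blinfun_apply (F' x)"])
      show "z + t *\<^sub>R (w - z) \<in> ?S" if "t \<in> {0..1}" for t
      proof -
        have "convex ?S" by (intro convex_Int convex_cball convex_ball)
        moreover have "z \<in> ?S" "w \<in> ?S" using zw \<open>r > 0\<close> by (auto simp: dist_commute)
        ultimately have "(1 - t) *\<^sub>R z + t *\<^sub>R w \<in> ?S"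
          using that by (intro convexD) auto
        then show ?thesis by (simp add: algebra_simps)
      qed
      show "(F has_derivative blinfun_apply (F' x)) (at x within ?S)" for x
        by (rule has_derivative_at_withinI[OF der])
      show "onorm (blinfun_apply (F' x) - blinfun_apply (F' z)) \<le> \<epsilon>" if "x \<in> ?S" for x
        using r(2)[of z x] that zw
        by (simp add: dist_norm norm_blinfun.rep_eq minus_blinfun.rep_eq fun_diff_def norm_minus_commute)
      show "z \<in> ?S" using zw \<open>r > 0\<close> by auto
    qed
    then show "norm (F w - F z - F' z (w - z)) \<le> \<epsilon> * norm (w - z)"
      by (simp add: mult.commute)
  qed (fact \<open>r > 0\<close>)
qed

text \<open>The approximating map may depend on \<open>\<epsilon>\<close>. Two good approximations
  agree up to a small factor on short vectors, hence by linearity on all vectors, so they form a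
  Cauchy sequence in operator norm; its limit is the derivative.\<close>

lemma differentiable_if_approx_linear:
  fixes f :: "'a::real_normed_vector \<Rightarrow> 'b::banach"
  assumes approx: "\<And>\<epsilon>. \<epsilon> > 0 \<Longrightarrow> \<exists>L r. bounded_linear L \<and> r > 0 \<and>
      (\<forall>a. norm a < r \<longrightarrow> norm (f (x + a) - f x - L a) \<le> \<epsilon> * norm a)"
  shows "f differentiable (at x)"
proof -
  have "\<exists>(L :: 'a \<Rightarrow>\<^sub>L 'b) r. r > 0 \<and>
      (\<forall>a. norm a < r \<longrightarrow> norm (f (x + a) - f x - L a) \<le> inverse (real (Suc n)) * norm a)" for n
    using approx[of "inverse (real (Suc n))"] bounded_linear_Blinfun_apply
    by (metis inverse_positive_iff_positive of_nat_0_less_iff zero_less_Suc)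
  then obtain L :: "nat \<Rightarrow> 'a \<Rightarrow>\<^sub>L 'b" and r where r: "\<And>n. r n > 0"
    and L: "\<And>n a. norm a < r n \<Longrightarrow> norm (f (x + a) - f x - L n a) \<le> inverse (real (Suc n)) * norm a"
    by metis
  have close: "norm (L m - L n) \<le> 2 * inverse (real (Suc N))" if mn: "N \<le> m" "N \<le> n" for m n N
  proof (rule norm_blinfun_bound)
    fix a :: 'a
    show "norm (blinfun_apply (L m - L n) a) \<le> 2 * inverse (real (Suc N)) * norm a"
    proof (cases "a = 0")
      case False
      \<comment> \<open>Scales \<open>a\<close> into both balls of validity; linearity later cancels
        the factor.\<close>
      define c where "c = min (r m) (r n) / (2 * norm a)"
      have c: "c > 0" using r[of m] r[of n] False by (simp add: c_def)
      have "norm (c *\<^sub>R a) = min (r m) (r n) / 2"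
        using r[of m] r[of n] False by (simp add: c_def)
      then have small: "norm (c *\<^sub>R a) < r m" "norm (c *\<^sub>R a) < r n"
        using r[of m] r[of n] by auto
      have "inverse (real (Suc k)) * norm (c *\<^sub>R a) \<le> inverse (real (Suc N)) * norm (c *\<^sub>R a)"
        if "N \<le> k" for k
        using that by (intro mult_right_mono) (auto intro: le_imp_inverse_le)
      then have "norm (f (x + c *\<^sub>R a) - f x - L m (c *\<^sub>R a)) \<le> inverse (real (Suc N)) * norm (c *\<^sub>R a)"
        "norm (f (x + c *\<^sub>R a) - f x - L n (c *\<^sub>R a)) \<le> inverse (real (Suc N)) * norm (c *\<^sub>R a)"
        using L small mn order_trans by blast+
      then have "norm (L m (c *\<^sub>R a) - L n (c *\<^sub>R a)) \<le> 2 * (inverse (real (Suc N)) * norm (c *\<^sub>R a))"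
        using norm_triangle_ineq4[of "f (x + c *\<^sub>R a) - f x - L n (c *\<^sub>R a)"
            "f (x + c *\<^sub>R a) - f x - L m (c *\<^sub>R a)"] by simp
      then have "c * norm (L m a - L n a) \<le> c * (2 * inverse (real (Suc N)) * norm a)"
        using c by (simp add: blinfun.scaleR_right scaleR_diff_right[symmetric])
      then show ?thesis
        using c by (simp add: blinfun.diff_left)
    qed simp
  qed simp
  have small: "\<exists>N. 2 * inverse (real (Suc N)) < e" if "e > 0" for e
    using reals_Archimedean[of "e / 2"] that by (auto simp: field_simps simp del: of_nat_Suc)
  have "Cauchy L"
  proof (rule metric_CauchyI)
    fix e :: real assume "e > 0"
    then obtain N where "2 * inverse (real (Suc N)) < e"
      using small by blast
    then have "dist (L m) (L n) < e" if "N \<le> m" "N \<le> n" for m n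
      unfolding dist_norm by (rule order_le_less_trans[OF close[OF that]])
    then show "\<exists>M. \<forall>m\<ge>M. \<forall>n\<ge>M. dist (L m) (L n) < e"
      by blast
  qed
  then obtain L' where lim: "L \<longlonglongrightarrow> L'"
    using Cauchy_convergent_iff convergent_def by blast
  have "(f has_derivative blinfun_apply L') (at x)"
    unfolding has_derivative_within_alt2
  proof (intro conjI allI impI)
    fix e :: real assume "e > 0"
    \<comment> \<open>One half of \<open>e\<close> pays for the error of \<open>L N\<close>, the
      other for replacing \<open>L N\<close> by \<open>L'\<close>.\<close>
    then obtain N where N: "2 * inverse (real (Suc N)) < e / 2"
      using small[of "e / 2"] by fastforce
    have "norm (L' - L N) \<le> 2 * inverse (real (Suc N))"
      using lim close[of N _ N]
      by (intro tendsto_upperbound[of "\<lambda>n. norm (L n - L N)" _ sequentially])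
        (auto intro!: tendsto_intros eventually_sequentiallyI[of N])
    then have L': "norm ((L' - L N) a) \<le> e / 2 * norm a" for a
      using N norm_blinfun[of "L' - L N" a] mult_right_mono[of "norm (L' - L N)" "e / 2" "norm a"]
      by simp
    have "norm (f y - f x - L' (y - x)) \<le> e * norm (y - x)" if "dist y x < r N" for y
    proof -
      have "norm (f y - f x - L N (y - x)) \<le> inverse (real (Suc N)) * norm (y - x)"
        using L[of "y - x" N] that by (simp add: dist_norm)
      also have "\<dots> \<le> e / 2 * norm (y - x)"
      proof (rule mult_right_mono)
        have "0 \<le> inverse (real (Suc N))" by simp
        then show "inverse (real (Suc N)) \<le> e / 2" using N by linarith
      qed simp
      finally show ?thesis
        using norm_triangle_ineq4[of "f y - f x - L N (y - x)" "(L' - L N) (y - x)"] L'[of "y - x"]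
        by (simp add: blinfun.diff_left algebra_simps)
    qed
    then show "eventually (\<lambda>y. norm (f y - f x - L' (y - x)) \<le> e * norm (y - x)) (at x)"
      unfolding eventually_at using r by blast
  qed (rule blinfun.bounded_linear_right)
  then show ?thesis by (auto simp: differentiable_def)
qed

section \<open>Uniqueness of solutions\<close>

lemma solution_bounded:
  fixes x :: "real \<Rightarrow> 'a::real_normed_vector"
  assumes "\<And>t. (x has_vector_derivative x' t) (at t)"
  obtains R where "\<And>t. \<bar>t\<bar> \<le> T \<Longrightarrow> norm (x t) \<le> R"
proof -
  have "compact (x ` {-T..T})"
    by (intro compact_continuous_image continuous_at_imp_continuous_on ballI compact_Icc
        has_vector_derivative_continuous[OF assms])
  then obtain R where R: "\<And>t. t \<in> {-T..T} \<Longrightarrow> norm (x t) \<le> R"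
    using compact_imp_bounded bounded_pos by (metis imageI)
  show thesis
    by (rule that[of R], rule R) (simp add: abs_le_iff)
qed

lemma solution_unique:
  fixes F :: "'a::euclidean_space \<Rightarrow> 'a"
  assumes der: "\<And>x. (F has_derivative blinfun_apply (F' x)) (at x)"
    and cont: "continuous_on UNIV F'"
    and x: "\<And>t. (x has_vector_derivative F (x t)) (at t)"
    and y: "\<And>t. (y has_vector_derivative F (y t)) (at t)"
    and init: "x t\<^sub>0 = y t\<^sub>0"
  shows "x = y"
proof
  fix t
  define T where "T = \<bar>t - t\<^sub>0\<bar>"
  obtain R1 where R1: "\<And>t. \<bar>t\<bar> \<le> \<bar>t\<^sub>0\<bar> + T \<Longrightarrow> norm (x t) \<le> R1"
    using solution_bounded[OF x] by blast
  obtain R2 where R2: "\<And>t. \<bar>t\<bar> \<le> \<bar>t\<^sub>0\<bar> + T \<Longrightarrow> norm (y t) \<le> R2"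
    using solution_bounded[OF y] by blast
  obtain K where K: "0 \<le> K"
    "\<And>z w. z \<in> cball 0 (max R1 R2) \<Longrightarrow> w \<in> cball 0 (max R1 R2) \<Longrightarrow> norm (F z - F w) \<le> K * norm (z - w)"
    using C1_lipschitz_on_cball[OF der cont] by metis
  have shift: "((\<lambda>s. z (t\<^sub>0 + s)) has_vector_derivative F (z (t\<^sub>0 + s))) (at s)"
    if "\<And>t. (z has_vector_derivative F (z t)) (at t)" for z :: "real \<Rightarrow> 'a" and s
    using vector_diff_chain_at[of "\<lambda>s. t\<^sub>0 + s" 1 s z, OF _ that]
      has_vector_derivative_add[OF has_vector_derivative_const has_vector_derivative_id]
    by (simp add: o_def)
  let ?D = "\<lambda>s. x (t\<^sub>0 + s) - y (t\<^sub>0 + s)"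
  \<comment> \<open>Both trajectories lie in the ball on the whole time range, so the Lipschitz
    bound holds there outright. The initial difference is 0, and any positive radius satisfies the
    smallness condition.\<close>
  have "norm (?D (t - t\<^sub>0)) \<le> exp ((2 * K + 1) * T) * (norm (?D 0) + 0)"
  proof (rule gronwall_local[where r = 1 and D' = "\<lambda>s. F (x (t\<^sub>0 + s)) - F (y (t\<^sub>0 + s))"])
    show "(?D has_vector_derivative F (x (t\<^sub>0 + s)) - F (y (t\<^sub>0 + s))) (at s)" for s
      by (intro has_vector_derivative_diff shift x y)
    show "norm (F (x (t\<^sub>0 + s)) - F (y (t\<^sub>0 + s))) \<le> K * norm (?D s) + 0" if "\<bar>s\<bar> \<le> T" for s
    proof -
      have "\<bar>t\<^sub>0 + s\<bar> \<le> \<bar>t\<^sub>0\<bar> + T" using that by linarith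
      then show ?thesis
        using K(2)[of "x (t\<^sub>0 + s)" "y (t\<^sub>0 + s)"] R1 R2 by (simp add: le_max_iff_disj)
    qed
  qed (use K init in \<open>auto simp: T_def\<close>)
  then show "x t = y t" using init by simp
qed

text \<open>The equation is autonomous, so solutions started at time 0 suffice; a general initial
  time is recovered later by a shift.\<close>

locale C1_flow =
  fixes F :: "'a::euclidean_space \<Rightarrow> 'a" and F' :: "'a \<Rightarrow> 'a \<Rightarrow>\<^sub>L 'a" and \<phi> :: "'a \<Rightarrow> real \<Rightarrow> 'a"
  assumes der: "\<And>x. (F has_derivative blinfun_apply (F' x)) (at x)"
    and cont: "continuous_on UNIV F'"
    and init [simp]: "\<phi> x 0 = x"
    and sol: "\<And>x t. (\<phi> x has_vector_derivative F (\<phi> x t)) (at t)"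
begin

lemma flow_shift: "\<phi> (\<phi> x s) t = \<phi> x (s + t)"
proof -
  have "((\<lambda>t. \<phi> x (s + t)) has_vector_derivative F (\<phi> x (s + t))) (at t)" for t
    using vector_diff_chain_at[of "\<lambda>t. s + t" 1 t "\<phi> x", OF _ sol]
      has_vector_derivative_add[OF has_vector_derivative_const has_vector_derivative_id]
    by (simp add: o_def)
  then have "\<phi> (\<phi> x s) = (\<lambda>t. \<phi> x (s + t))"
    by (intro solution_unique[OF der cont sol, where t\<^sub>0 = 0]) auto
  then show ?thesis by metis
qed

text \<open>With radius 1 in the local Gronwall inequality, a neighbouring trajectory stays within
  distance 1 of the reference one, hence in the ball of radius \<open>R + 1\<close> for which
  \<open>K\<close> was chosen. Starting closer than \<open>1 / E\<close> guarantees this.\<close>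

lemma locally_lipschitz:
  obtains r M where "r > 0" "M > 0"
    "\<And>y t. norm (y - x) < r \<Longrightarrow> \<bar>t\<bar> \<le> T \<Longrightarrow> norm (\<phi> y t - \<phi> x t) \<le> M * norm (y - x)"
proof -
  obtain R where R: "\<And>t. \<bar>t\<bar> \<le> T \<Longrightarrow> norm (\<phi> x t) \<le> R"
    using solution_bounded[OF sol] by blast
  obtain K where K: "0 \<le> K"
    "\<And>z w. z \<in> cball 0 (R + 1) \<Longrightarrow> w \<in> cball 0 (R + 1) \<Longrightarrow> norm (F z - F w) \<le> K * norm (z - w)"
    using C1_lipschitz_on_cball[OF der cont] by metis
  define E where "E = exp ((2 * K + 1) * T)"
  have "norm (\<phi> y t - \<phi> x t) \<le> E * norm (y - x)"
    if "norm (y - x) < 1 / E" "\<bar>t\<bar> \<le> T" for y t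
  proof -
    let ?D = "\<lambda>s. \<phi> y s - \<phi> x s"
    have "norm (?D t) \<le> exp ((2 * K + 1) * T) * (norm (?D 0) + 0)"
    proof (rule gronwall_local[where r = 1 and D' = "\<lambda>s. F (\<phi> y s) - F (\<phi> x s)"])
      show "(?D has_vector_derivative F (\<phi> y s) - F (\<phi> x s)) (at s)" for s
        by (intro has_vector_derivative_diff sol)
      show "norm (F (\<phi> y s) - F (\<phi> x s)) \<le> K * norm (?D s) + 0"
        if "\<bar>s\<bar> \<le> T" "norm (?D s) \<le> 1" for s
        using K(2)[of "\<phi> y s" "\<phi> x s"] R[OF that(1)] that(2) norm_triangle_sub[of "\<phi> y s" "\<phi> x s"]
        by simp
      have "E * norm (y - x) < 1"
        using that by (simp add: E_def field_simps)
      then show "exp ((2 * K + 1) * T) * (norm (?D 0) + 0) < 1"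
        by (simp add: E_def)
    qed (use that K in auto)
    then show ?thesis by (simp add: E_def)
  qed
  then show thesis
    by (intro that[of "1 / E" E]) (auto simp: E_def)
qed

text \<open>
  The increments of the flow satisfy the linear equation along the trajectory up to an error of
  small order, so by Gronwall's inequality the increment in direction \<open>a\<close> is close to the linear
  combination of increments along scaled basis vectors. The derivative is obtained as the limit of
  these combinations, and no solution of the variational equation has to be constructed.
\<close>

lemma flow_differentiable_state: "(\<lambda>x. \<phi> x t) differentiable (at x)"
proof (rule differentiable_if_approx_linear)
  fix \<epsilon> :: real assume "\<epsilon> > 0"
  define T where "T = \<bar>t\<bar>"
  obtain R where R: "\<And>t. \<bar>t\<bar> \<le> T \<Longrightarrow> norm (\<phi> x t) \<le> R"
    using solution_bounded[OF sol] by blast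
  obtain r\<^sub>0 M where M: "r\<^sub>0 > 0" "M > 0"
    "\<And>y t. norm (y - x) < r\<^sub>0 \<Longrightarrow> \<bar>t\<bar> \<le> T \<Longrightarrow> norm (\<phi> y t - \<phi> x t) \<le> M * norm (y - x)"
    using locally_lipschitz by blast
  obtain K where K: "0 \<le> K" "\<And>z. z \<in> cball 0 (R + 1) \<Longrightarrow> norm (F' z) \<le> K"
    using C1_lipschitz_on_cball[OF der cont] by metis
  define E where "E = exp ((2 * K + 1) * T)"
  define d where "d = real DIM('a)"
  \<comment> \<open>Each increment contributes an error \<open>\<epsilon>' * M * norm a\<close>: one
    for \<open>a\<close> itself and \<open>d\<close> for the basis directions. Gronwall multiplies
    the sum by \<open>E\<close>, and the product is \<open>\<epsilon> * norm a\<close>.\<close>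
  define \<epsilon>' where "\<epsilon>' = \<epsilon> / (E * M * (1 + d))"
  have pos: "E > 0" "d \<ge> 0" "\<epsilon>' > 0"
    using \<open>\<epsilon> > 0\<close> M by (auto simp: E_def d_def \<epsilon>'_def intro!: divide_pos_pos mult_pos_pos)
  obtain r\<^sub>1 where r\<^sub>1: "r\<^sub>1 > 0"
    "\<And>z w. z \<in> cball 0 (R + 1) \<Longrightarrow> w \<in> cball 0 (R + 1) \<Longrightarrow> dist w z < r\<^sub>1 \<Longrightarrow>
      norm (F w - F z - F' z (w - z)) \<le> \<epsilon>' * norm (w - z)"
    using C1_uniform_linearization[OF der cont pos(3)] by blast
  \<comment> \<open>The three bounds give the Lipschitz estimate, increments shorter than the
    linearization radius \<open>r\<^sub>1\<close>, and perturbed trajectories inside the ball of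
    radius \<open>R + 1\<close>.\<close>
  define \<rho> where "\<rho> = min r\<^sub>0 (min (r\<^sub>1 / M) (1 / M))"
  define h where "h = \<rho> / 2"
  have "\<rho> > 0" using M(1,2) r\<^sub>1(1) by (auto simp: \<rho>_def)
  then have \<rho>: "\<rho> > 0" "h > 0" "h < \<rho>" by (auto simp: h_def)
  define \<delta> where "\<delta> a s = \<phi> (x + a) s - \<phi> x s" for a s
  define \<delta>' where "\<delta>' a s = F (\<phi> (x + a) s) - F (\<phi> x s)" for a s
  have \<delta>_der: "(\<delta> a has_vector_derivative \<delta>' a s) (at s)" for a s
    unfolding \<delta>_def[abs_def] \<delta>'_def by (intro has_vector_derivative_diff sol)
  have rem: "norm (\<delta>' a s - F' (\<phi> x s) (\<delta> a s)) \<le> \<epsilon>' * M * norm a"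
    if "norm a < \<rho>" "\<bar>s\<bar> \<le> T" for a s
  proof -
    have le: "norm (\<delta> a s) \<le> M * norm a"
      using M(3)[of "x + a" s] that by (simp add: \<rho>_def \<delta>_def)
    have "M * norm a < M * \<rho>" using that M by simp
    also have "M * \<rho> \<le> min r\<^sub>1 1"
      using M by (auto simp: \<rho>_def min_def field_simps)
    finally have small: "norm (\<delta> a s) < r\<^sub>1" "norm (\<delta> a s) < 1" using le by auto
    have "norm (\<delta>' a s - F' (\<phi> x s) (\<delta> a s)) \<le> \<epsilon>' * norm (\<delta> a s)"
      unfolding \<delta>'_def \<delta>_def
      using R[OF that(2)] small norm_triangle_sub[of "\<phi> (x + a) s" "\<phi> x s"]
      by (intro r\<^sub>1(2)) (auto simp: \<delta>_def dist_norm)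
    also have "\<dots> \<le> \<epsilon>' * (M * norm a)" using le pos by simp
    finally show ?thesis by (simp add: mult.assoc)
  qed
  \<comment> \<open>Difference quotients of fixed step \<open>h\<close>, not limits:
    \<open>\<epsilon>\<close> is fixed here. At time 0 the same combination of increments is exactly
    \<open>a\<close>, so \<open>?D\<close> starts at 0.\<close>
  define L where "L a = (\<Sum>i\<in>Basis. ((a \<bullet> i) / h) *\<^sub>R \<delta> (h *\<^sub>R i) t)" for a
  have "bounded_linear L"
    unfolding L_def[abs_def]
    by (intro bounded_linear_sum bounded_linear_scaleR_const
        bounded_linear_compose[OF bounded_linear_divide] bounded_linear_inner_left)
  moreover have "norm (\<phi> (x + a) t - \<phi> x t - L a) \<le> \<epsilon> * norm a" if a: "norm a < \<rho>" for a
  proof -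
    let ?D = "\<lambda>s. \<delta> a s - (\<Sum>i\<in>Basis. ((a \<bullet> i) / h) *\<^sub>R \<delta> (h *\<^sub>R i) s)"
    let ?D' = "\<lambda>s. \<delta>' a s - (\<Sum>i\<in>Basis. ((a \<bullet> i) / h) *\<^sub>R \<delta>' (h *\<^sub>R i) s)"
    define \<eta> where "\<eta> = \<epsilon>' * M * (1 + d) * norm a"
    have D0: "?D 0 = 0"
      using \<rho> by (simp add: \<delta>_def euclidean_representation)
    \<comment> \<open>The estimate of \<open>?D'\<close> holds on the whole time interval, so the
      radius is simply put 1 above the expected bound.\<close>
    have "norm (?D t) \<le> exp ((2 * K + 1) * T) * (norm (?D 0) + \<eta>)"
    proof (rule gronwall_local[where r = "exp ((2 * K + 1) * T) * (norm (?D 0) + \<eta>) + 1" and D' = ?D'])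
      show "(?D has_vector_derivative ?D' s) (at s)" for s
        by (intro has_vector_derivative_diff has_vector_derivative_sum \<delta>_der
            bounded_linear.has_vector_derivative[OF bounded_linear_scaleR_right])
      show "norm (?D' s) \<le> K * norm (?D s) + \<eta>" if s: "\<bar>s\<bar> \<le> T" for s
      proof -
        let ?A = "blinfun_apply (F' (\<phi> x s))"
        let ?rem = "\<lambda>a. \<delta>' a s - ?A (\<delta> a s)"
        \<comment> \<open>The linear operator \<open>?A\<close> commutes with the combination, so
          only the linearization remainders survive as inhomogeneous term.\<close>
        have eq: "?D' s = ?A (?D s) + (?rem a - (\<Sum>i\<in>Basis. ((a \<bullet> i) / h) *\<^sub>R ?rem (h *\<^sub>R i)))"
          by (simp add: blinfun.diff_right blinfun.sum_right blinfun.scaleR_right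
              scaleR_diff_right sum_subtractf)
        have "norm (((a \<bullet> i) / h) *\<^sub>R ?rem (h *\<^sub>R i)) \<le> \<epsilon>' * M * norm a" if i: "i \<in> Basis" for i
        proof -
          have "norm (?rem (h *\<^sub>R i)) \<le> \<epsilon>' * M * h"
            using rem[of "h *\<^sub>R i" s] s i \<rho> by simp
          then have "\<bar>a \<bullet> i\<bar> / h * norm (?rem (h *\<^sub>R i)) \<le> norm a / h * (\<epsilon>' * M * h)"
            using Basis_le_norm[OF i, of a] \<rho> by (intro mult_mono divide_right_mono) auto
          then show ?thesis using \<rho> by (simp add: mult_ac)
        qed
        then have "norm (\<Sum>i\<in>Basis. ((a \<bullet> i) / h) *\<^sub>R ?rem (h *\<^sub>R i)) \<le> d * (\<epsilon>' * M * norm a)"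
          unfolding d_def by (intro sum_norm_bound)
        then have "norm (?rem a - (\<Sum>i\<in>Basis. ((a \<bullet> i) / h) *\<^sub>R ?rem (h *\<^sub>R i))) \<le> \<eta>"
          using rem[OF a s] norm_triangle_ineq4[of "?rem a" "\<Sum>i\<in>Basis. ((a \<bullet> i) / h) *\<^sub>R ?rem (h *\<^sub>R i)"]
          by (simp add: \<eta>_def algebra_simps)
        moreover have "norm (?A (?D s)) \<le> K * norm (?D s)"
        proof -
          have "norm (F' (\<phi> x s)) \<le> K" using K(2)[of "\<phi> x s"] R[OF s] by simp
          then show ?thesis
            using norm_blinfun[of "F' (\<phi> x s)" "?D s"] mult_right_mono[OF _ norm_ge_zero]
            by (meson order_trans)
        qed
        ultimately show ?thesis
          unfolding eq
          by (intro order_trans[OF norm_triangle_ineq] add_mono)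
      qed
    qed (use K pos M in \<open>auto simp: \<eta>_def T_def\<close>)
    also have "\<dots> = \<epsilon> * norm a"
      using pos M(2) unfolding D0 E_def[symmetric] \<eta>_def \<epsilon>'_def by simp
    finally show ?thesis by (simp add: L_def \<delta>_def)
  qed
  ultimately show "\<exists>L r. bounded_linear L \<and> r > 0 \<and>
      (\<forall>a. norm a < r \<longrightarrow> norm (\<phi> (x + a) t - \<phi> x t - L a) \<le> \<epsilon> * norm a)"
    using \<rho> by blast
qed

text \<open>Splits the increment: the Lipschitz bound in the state is uniform for times near
  \<open>t\<close>, and the reference trajectory is continuous in time.\<close>

lemma isCont_flow: "isCont (\<lambda>(x, t). \<phi> x t) (x, t)"
proof -
  obtain r M where M: "r > 0"
    "\<And>y s. norm (y - x) < r \<Longrightarrow> \<bar>s\<bar> \<le> \<bar>t\<bar> + 1 \<Longrightarrow> norm (\<phi> y s - \<phi> x s) \<le> M * norm (y - x)"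
    using locally_lipschitz by metis
  have "isCont (\<phi> x) t"
    by (rule has_vector_derivative_continuous[OF sol])
  then have lim: "((\<lambda>p. \<phi> x (snd p)) \<longlongrightarrow> \<phi> x t) (at (x, t))"
    by (intro isCont_tendsto_compose[of t "\<phi> x"]) (auto intro!: tendsto_eq_intros)
  have ev: "eventually (\<lambda>p. norm (fst p - x) < r \<and> \<bar>snd p - t\<bar> < 1) (at (x, t))"
  proof (rule eventually_conj)
    have "((\<lambda>p. norm (fst p - x)) \<longlongrightarrow> 0) (at (x, t))"
      "((\<lambda>p. \<bar>snd p - t\<bar>) \<longlongrightarrow> 0) (at (x, t))"
      by (auto intro!: tendsto_eq_intros)
    then show "eventually (\<lambda>p. norm (fst p - x) < r) (at (x, t))"
      "eventually (\<lambda>p. \<bar>snd p - t\<bar> < 1) (at (x, t))"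
      using M(1) order_tendstoD(2) zero_less_one by blast+
  qed
  have "((\<lambda>p. \<phi> (fst p) (snd p) - \<phi> x (snd p)) \<longlongrightarrow> 0) (at (x, t))"
  proof (rule Lim_null_comparison)
    show "eventually (\<lambda>p. norm (\<phi> (fst p) (snd p) - \<phi> x (snd p)) \<le> M * norm (fst p - x)) (at (x, t))"
      using ev by eventually_elim (rule M(2), auto)
    show "((\<lambda>p. M * norm (fst p - x)) \<longlongrightarrow> 0) (at (x, t))"
      by (auto intro!: tendsto_eq_intros)
  qed
  from tendsto_add[OF this lim] show ?thesis
    by (simp add: isCont_def case_prod_unfold)
qed

text \<open>Differentiating \<open>\<phi> (\<phi> x s) t = \<phi> x (s + t)\<close> at
  \<open>s = 0\<close> in two ways gives \<open>L (F x) = F (\<phi> x t)\<close>. Joint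
  differentiability combines the state derivative at the point with the jointly continuous time
  derivative.\<close>

lemma flow_has_derivative:
  obtains L where "bounded_linear L" "L (F x) = F (\<phi> x t)"
    "((\<lambda>(x, t). \<phi> x t) has_derivative (\<lambda>(a, s). L a + s *\<^sub>R F (\<phi> x t))) (at (x, t))"
proof -
  obtain L where L: "((\<lambda>x. \<phi> x t) has_derivative L) (at x)"
    using flow_differentiable_state[of t x] by (auto simp: differentiable_def)
  have "((\<lambda>s. \<phi> (\<phi> x s) t) has_vector_derivative L (F x)) (at 0)"
  proof -
    have "((\<lambda>s. \<phi> x s) has_derivative (\<lambda>s. s *\<^sub>R F x)) (at 0)"
      using sol[of x 0] by (simp add: has_vector_derivative_def)
    from has_derivative_compose[OF this, of "\<lambda>x. \<phi> x t" L] L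
    show ?thesis
      by (simp add: has_vector_derivative_def linear_cmul[OF has_derivative_linear[OF L]])
  qed
  moreover have "((\<lambda>s. \<phi> (\<phi> x s) t) has_vector_derivative F (\<phi> x t)) (at 0)"
    using vector_diff_chain_at[of "\<lambda>s. s + t" 1 0 "\<phi> x", OF _ sol]
      has_vector_derivative_add[OF has_vector_derivative_id has_vector_derivative_const]
    by (simp add: o_def flow_shift)
  ultimately have invariant: "L (F x) = F (\<phi> x t)"
    by (rule vector_derivative_unique_at)
  have "((\<lambda>(x, t). \<phi> x t) has_derivative
      (\<lambda>(a, s). L a + blinfun_apply (blinfun_scaleR_left (F (\<phi> x t))) s)) (at (x, t) within UNIV \<times> UNIV)"
  proof (rule has_derivative_partialsI)
    show "(\<phi> y has_derivative blinfun_apply (blinfun_scaleR_left (F (\<phi> y s)))) (at s within UNIV)" for y s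
      using sol[of y s] by (simp add: has_vector_derivative_def)
    have "isCont F z" for z
      using has_derivative_continuous[OF der] by simp
    from isCont_o2[OF isCont_flow this]
    have "isCont (\<lambda>p. F (\<phi> (fst p) (snd p))) (x, t)"
      by (simp add: case_prod_unfold)
    then have "isCont (\<lambda>p. blinfun_scaleR_left (F (\<phi> (fst p) (snd p)))) (x, t)"
      by (rule bounded_linear.isCont[OF bounded_linear_blinfun_scaleR_left])
    then show "continuous (at (x, t) within UNIV \<times> UNIV) (\<lambda>(y, s). blinfun_scaleR_left (F (\<phi> y s)))"
      by (simp add: case_prod_unfold)
  qed (use L in auto)
  with that[of L] show thesis
    using has_derivative_bounded_linear[OF L] invariant by simp
qed

end

section \<open>First zeros and their perturbation\<close>

text \<open>As \<open>f s \<noteq> 0\<close>, the strict inequality may be relaxed to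
  \<open>s \<le> t\<close> without changing the set. It is then closed and contains its
  infimum.\<close>

lemma first_zero_mem:
  fixes f :: "real \<Rightarrow> real"
  assumes "continuous_on UNIV f" "f s \<noteq> 0" "{t. s < t \<and> f t = 0} \<noteq> {}"
  shows "Inf {t. s < t \<and> f t = 0} \<in> {t. s < t \<and> f t = 0}"
proof (rule closed_contains_Inf)
  have "{t. s < t \<and> f t = 0} = {s..} \<inter> f -` {0}"
    using assms(2) by (auto simp: less_le)
  moreover have "closed ({s..} \<inter> f -` {0})"
    using assms(1) by (intro closed_Int closed_vimage) auto
  ultimately show "closed {t. s < t \<and> f t = 0}" by simp
  show "bdd_below {t. s < t \<and> f t = 0}"
    by (rule bdd_belowI[of _ s]) auto
qed fact

lemma first_zero_perturbation_pos:
  fixes H :: "'p::topological_space \<times> real \<Rightarrow> real" and \<sigma> :: "'p \<Rightarrow> real"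
  defines "A \<equiv> \<lambda>q. {t. \<sigma> q < t \<and> H (q, t) = 0}"
  assumes H: "continuous_on UNIV H" and \<sigma>: "continuous_on UNIV \<sigma>"
    and start: "H (p, \<sigma> p) \<noteq> 0" and hit: "A p \<noteq> {}"
    and der: "DERIV (\<lambda>t. H (p, t)) (Inf (A p)) :> c" and "c > 0" and "e > 0"
  shows "eventually (\<lambda>q. A q \<noteq> {} \<and> \<bar>Inf (A q) - Inf (A p)\<bar> < e) (nhds p)"
proof -
  define \<tau> where "\<tau> = Inf (A p)"
  have Hq: "continuous_on T (\<lambda>t. H (q, t))" for q T
    by (rule continuous_on_compose2[OF H]) (auto intro!: continuous_intros)
  have "\<tau> \<in> A p"
    using first_zero_mem[OF Hq start] hit by (simp add: \<tau>_def A_def)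
  then have \<tau>: "\<sigma> p < \<tau>" "H (p, \<tau>) = 0" by (auto simp: A_def)
  have bdd: "bdd_below (A q)" for q
    by (rule bdd_belowI[of _ "\<sigma> q"]) (auto simp: A_def)
  obtain d1 where d1: "d1 > 0" "\<And>h. h > 0 \<Longrightarrow> h < d1 \<Longrightarrow> H (p, \<tau>) < H (p, \<tau> + h)"
    using DERIV_pos_inc_right[OF der \<open>c > 0\<close>] by (auto simp: \<tau>_def)
  obtain d2 where d2: "d2 > 0" "\<And>h. h > 0 \<Longrightarrow> h < d2 \<Longrightarrow> H (p, \<tau> - h) < H (p, \<tau>)"
    using DERIV_pos_inc_left[OF der \<open>c > 0\<close>] by (auto simp: \<tau>_def)
  \<comment> \<open>Below \<open>d1\<close> and \<open>d2\<close> the signs on either side of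
    \<open>\<tau>\<close> are known; below \<open>e\<close> the zero is close enough; below
    \<open>\<tau> - \<sigma> p\<close> the point \<open>\<tau> - h\<close> lies after the
    start.\<close>
  obtain h where h: "0 < h" "h < min (min d1 d2) (min e (\<tau> - \<sigma> p))"
    using dense[of 0 "min (min d1 d2) (min e (\<tau> - \<sigma> p))"] d1 d2 \<tau> \<open>e > 0\<close> by auto
  then have sign: "H (p, \<tau> - h) < 0" "0 < H (p, \<tau> + h)" and "h < e" "\<sigma> p < \<tau> - h"
    using d1(2)[of h] d2(2)[of h] \<tau> by auto
  \<comment> \<open>The interval from \<open>\<sigma> q\<close> to \<open>\<tau> - h\<close>, to be
    kept free of zeros, moves with \<open>q\<close>. Rescaling it to \<open>{0..1}\<close> makes the
    tube lemma applicable.\<close>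
  define W where "W = {z. H (fst z, \<sigma> (fst z) + snd z * (\<tau> - h - \<sigma> (fst z))) \<noteq> 0}"
  have \<sigma>': "continuous_on T (\<lambda>z. \<sigma> (fst z))" for T :: "('p \<times> real) set"
    by (rule continuous_on_compose2[OF \<sigma>]) (auto intro!: continuous_intros)
  have "open W"
    unfolding W_def
    by (intro open_Collect_neq continuous_on_compose2[OF H] continuous_intros \<sigma>') auto
  moreover have "{p} \<times> {0..1} \<subseteq> W"
  proof clarsimp
    fix \<theta> :: real assume \<theta>: "0 \<le> \<theta>" "\<theta> \<le> 1"
    show "(p, \<theta>) \<in> W"
    proof (rule ccontr)
      define t where "t = \<sigma> p + \<theta> * (\<tau> - h - \<sigma> p)"
      assume "(p, \<theta>) \<notin> W"
      then have "H (p, t) = 0" by (simp add: W_def t_def)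
      moreover have "\<theta> * (\<tau> - h - \<sigma> p) \<le> \<tau> - h - \<sigma> p"
        using \<theta> \<open>\<sigma> p < \<tau> - h\<close> by (intro mult_left_le_one_le) auto
      then have "t < \<tau>" using \<open>0 < h\<close> unfolding t_def by linarith
      moreover have "\<sigma> p \<le> t"
        using \<theta> \<open>\<sigma> p < \<tau> - h\<close> by (simp add: t_def)
      ultimately have "t \<in> A p" using start by (cases "t = \<sigma> p") (auto simp: A_def)
      then have "\<tau> \<le> t" unfolding \<tau>_def using bdd by (rule cInf_lower)
      then show False using \<open>t < \<tau>\<close> by simp
    qed
  qed
  ultimately obtain X where X: "p \<in> X" "open X" "X \<times> {0..1} \<subseteq> W"
    using Elementary_Topology.tube_lemma[OF compact_Icc] by metis
  have Ht: "continuous_on UNIV (\<lambda>q. H (q, t))" for t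
    by (rule continuous_on_compose2[OF H]) (auto intro!: continuous_intros)
  \<comment> \<open>Membership in \<open>X\<close> excludes zeros up to \<open>\<tau> - h\<close>,
    the two signs force one in the window around \<open>\<tau>\<close>, and the last condition
    places it after \<open>\<sigma> q\<close>.\<close>
  have "open (X \<inter> {q. H (q, \<tau> - h) < 0} \<inter> {q. 0 < H (q, \<tau> + h)} \<inter> {q. \<sigma> q < \<tau> - h})"
    using X(2) by (intro open_Int open_Collect_less Ht \<sigma> continuous_on_const) auto
  moreover have "A q \<noteq> {} \<and> \<bar>Inf (A q) - \<tau>\<bar> < e"
    if q: "q \<in> X \<inter> {q. H (q, \<tau> - h) < 0} \<inter> {q. 0 < H (q, \<tau> + h)} \<inter> {q. \<sigma> q < \<tau> - h}" for q
  proof -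
    obtain t where t: "\<tau> - h \<le> t" "t \<le> \<tau> + h" "H (q, t) = 0"
      using IVT'[of "\<lambda>t. H (q, t)" "\<tau> - h" 0 "\<tau> + h"] Hq q \<open>0 < h\<close> by auto
    then have tA: "t \<in> A q" using q by (auto simp: A_def)
    then have "Inf (A q) \<le> \<tau> + h" using cInf_lower[OF tA bdd] t by simp
    moreover have "\<tau> - h \<le> Inf (A q)"
    proof (rule cInf_greatest)
      fix u assume u: "u \<in> A q"
      show "\<tau> - h \<le> u"
      proof (rule ccontr)
        assume "\<not> \<tau> - h \<le> u"
        define \<theta> where "\<theta> = (u - \<sigma> q) / (\<tau> - h - \<sigma> q)"
        have "\<theta> \<in> {0..1}" "\<sigma> q + \<theta> * (\<tau> - h - \<sigma> q) = u"
          using u q \<open>\<not> \<tau> - h \<le> u\<close> by (auto simp: \<theta>_def A_def)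
        moreover have "(q, \<theta>) \<in> W" using X(3) q \<open>\<theta> \<in> {0..1}\<close> by blast
        ultimately show False using u by (simp add: W_def A_def)
      qed
    qed (use tA in blast)
    ultimately show ?thesis using tA \<open>h < e\<close> by auto
  qed
  ultimately show ?thesis
    unfolding eventually_nhds using X(1) sign \<open>\<sigma> p < \<tau> - h\<close> \<tau>_def by blast
qed

text \<open>A negative slope becomes positive on replacing \<open>H\<close> by its negative, which
  has the same zeros.\<close>

lemma first_zero_perturbation:
  fixes H :: "'p::topological_space \<times> real \<Rightarrow> real" and \<sigma> :: "'p \<Rightarrow> real"
  defines "A \<equiv> \<lambda>q. {t. \<sigma> q < t \<and> H (q, t) = 0}"
  assumes H: "continuous_on UNIV H" and \<sigma>: "continuous_on UNIV \<sigma>"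
    and start: "H (p, \<sigma> p) \<noteq> 0" and hit: "A p \<noteq> {}"
    and der: "DERIV (\<lambda>t. H (p, t)) (Inf (A p)) :> c" and "c \<noteq> 0" and "e > 0"
  shows "eventually (\<lambda>q. A q \<noteq> {} \<and> \<bar>Inf (A q) - Inf (A p)\<bar> < e) (nhds p)"
proof (cases "c > 0")
  case True
  then show ?thesis
    using first_zero_perturbation_pos[OF H \<sigma> start _ _ _ \<open>e > 0\<close>] hit der by (simp add: A_def)
next
  case False
  have A: "A q = {t. \<sigma> q < t \<and> - H (q, t) = 0}" for q by (simp add: A_def)
  have "continuous_on UNIV (\<lambda>z. - H z)" "- H (p, \<sigma> p) \<noteq> 0" "- c > 0"
    using H start False \<open>c \<noteq> 0\<close> by (auto intro: continuous_on_minus)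
  moreover have "DERIV (\<lambda>t. - H (p, t)) (Inf (A p)) :> - c"
    using der by (rule DERIV_minus)
  ultimately show ?thesis
    using first_zero_perturbation_pos[of "\<lambda>z. - H z" \<sigma> p "- c" e] \<sigma> hit \<open>e > 0\<close>
    unfolding A by blast
qed

text \<open>Continuity of \<open>\<tau>\<close> brings \<open>(q, \<tau> q)\<close> into the region
  where \<open>H\<close> is close to its linearization. This first gives the crude bound
  \<open>\<bar>\<Delta>\<bar> \<le> norm v * M\<close>; inserting it back turns the error into a
  small multiple of \<open>norm v\<close>.\<close>

lemma implicit_has_derivative:
  fixes H :: "'p::real_normed_vector \<times> real \<Rightarrow> real" and \<tau> :: "'p \<Rightarrow> real"
  assumes H: "(H has_derivative H') (at (p, \<tau> p))" and c: "H' (0, 1) \<noteq> 0"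
    and cont: "isCont \<tau> p" and zero: "eventually (\<lambda>q. H (q, \<tau> q) = 0) (nhds p)"
  shows "(\<tau> has_derivative (\<lambda>v. - H' (v, 0) / H' (0, 1))) (at p)"
  unfolding has_derivative_within_alt2
proof (intro conjI allI impI)
  have lin: "bounded_linear H'" by (rule has_derivative_bounded_linear[OF H])
  interpret H': bounded_linear H' by (rule lin)
  have H'0: "bounded_linear (\<lambda>v. H' (v, 0))"
    by (rule bounded_linear_compose[OF lin])
      (intro bounded_linear_Pair bounded_linear_ident bounded_linear_zero)
  then show "bounded_linear (\<lambda>v. - H' (v, 0) / H' (0, 1))"
    by (intro bounded_linear_compose[OF bounded_linear_divide] bounded_linear_minus)
  obtain B where B: "B > 0" "\<And>v. \<bar>H' (v, 0)\<bar> \<le> norm v * B"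
    using bounded_linear.pos_bounded[OF H'0] by auto
  let ?c = "H' (0, 1)"
  \<comment> \<open>With \<open>\<eta> \<le> \<bar>?c\<bar> / 2\<close>, half of
    \<open>\<bar>\<Delta>\<bar> * \<bar>?c\<bar>\<close> is absorbed on the left; solving for
    \<open>\<bar>\<Delta>\<bar>\<close> leaves exactly this constant.\<close>
  define M where "M = 2 * B / \<bar>?c\<bar> + 1"
  have Mc: "M * \<bar>?c\<bar> = 2 * B + \<bar>?c\<bar>" using c by (simp add: M_def distrib_right)
  have "M > 0" using B c by (auto simp: M_def intro!: add_pos_pos)
  fix e :: real assume "e > 0"
  define \<eta> where "\<eta> = min (\<bar>?c\<bar> / 2) (e * \<bar>?c\<bar> / (1 + M))"
  have \<eta>: "\<eta> > 0" "\<eta> \<le> \<bar>?c\<bar> / 2" "\<eta> * (1 + M) \<le> e * \<bar>?c\<bar>"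
  proof -
    show "\<eta> > 0" using c \<open>e > 0\<close> \<open>M > 0\<close> by (simp add: \<eta>_def)
    show "\<eta> \<le> \<bar>?c\<bar> / 2" unfolding \<eta>_def by (rule min.cobounded1)
    have "\<eta> \<le> e * \<bar>?c\<bar> / (1 + M)" by (simp add: \<eta>_def)
    then show "\<eta> * (1 + M) \<le> e * \<bar>?c\<bar>" using \<open>M > 0\<close> by (simp add: pos_le_divide_eq)
  qed
  have "eventually (\<lambda>z. norm (H z - H (p, \<tau> p) - H' (z - (p, \<tau> p))) \<le> \<eta> * norm (z - (p, \<tau> p)))
      (at (p, \<tau> p))"
    using H \<eta>(1) unfolding has_derivative_within_alt2 by blast
  \<comment> \<open>The estimate is trivial at the centre, so it holds on full neighbourhoods and
    can be composed with the graph map of \<open>\<tau>\<close>.\<close>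
  then have "eventually (\<lambda>z. norm (H z - H (p, \<tau> p) - H' (z - (p, \<tau> p))) \<le> \<eta> * norm (z - (p, \<tau> p)))
      (nhds (p, \<tau> p))"
    unfolding eventually_at_filter by eventually_elim (auto simp: H'.zero)
  moreover have "filterlim (\<lambda>q. (q, \<tau> q)) (nhds (p, \<tau> p)) (nhds p)"
    using cont by (intro tendsto_Pair filterlim_ident) (simp add: isCont_def tendsto_at_iff_tendsto_nhds)
  ultimately have "eventually (\<lambda>q. norm (H (q, \<tau> q) - H (p, \<tau> p) - H' ((q, \<tau> q) - (p, \<tau> p)))
      \<le> \<eta> * norm ((q, \<tau> q) - (p, \<tau> p))) (nhds p)"
    by (rule eventually_compose_filterlim)
  then have "eventually (\<lambda>q. norm (\<tau> q - \<tau> p - (- H' (q - p, 0) / ?c)) \<le> e * norm (q - p)) (nhds p)"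
    using zero
  proof eventually_elim
    case (elim q)
    define v where "v = q - p"
    define \<Delta> where "\<Delta> = \<tau> q - \<tau> p"
    have "H (p, \<tau> p) = 0" using zero by (rule eventually_nhds_x_imp_x)
    moreover have "H' (v, \<Delta>) = \<Delta> * ?c + H' (v, 0)"
      using H'.add[of "\<Delta> *\<^sub>R (0, 1)" "(v, 0)"] H'.scaleR[of \<Delta> "(0, 1)"] by simp
    ultimately have "\<bar>\<Delta> * ?c + H' (v, 0)\<bar> \<le> \<eta> * norm (v, \<Delta>)"
      using elim by (simp add: v_def \<Delta>_def)
    also have "\<dots> \<le> \<eta> * (norm v + \<bar>\<Delta>\<bar>)"
      using \<eta>(1) norm_Pair_le[of v \<Delta>] by simp
    finally have main: "\<bar>\<Delta> * ?c + H' (v, 0)\<bar> \<le> \<eta> * (norm v + \<bar>\<Delta>\<bar>)" .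
    have "\<bar>\<Delta> * ?c\<bar> \<le> \<bar>\<Delta> * ?c + H' (v, 0)\<bar> + \<bar>H' (v, 0)\<bar>" by simp
    also have "\<dots> \<le> \<eta> * (norm v + \<bar>\<Delta>\<bar>) + norm v * B" using main B(2)[of v] by simp
    also have "\<dots> \<le> \<bar>?c\<bar> / 2 * (norm v + \<bar>\<Delta>\<bar>) + norm v * B"
      using \<eta>(2) by (intro add_right_mono mult_right_mono) auto
    finally have "\<bar>\<Delta>\<bar> * \<bar>?c\<bar> \<le> norm v * (M * \<bar>?c\<bar>)"
      unfolding Mc by (simp add: abs_mult field_simps)
    then have "\<bar>\<Delta>\<bar> * \<bar>?c\<bar> \<le> (norm v * M) * \<bar>?c\<bar>" by (simp add: mult.assoc)
    then have "\<bar>\<Delta>\<bar> \<le> norm v * M" using c by simp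
    then have "\<eta> * (norm v + \<bar>\<Delta>\<bar>) \<le> \<eta> * (norm v + norm v * M)" using \<eta>(1) by simp
    also have "\<dots> = \<eta> * (1 + M) * norm v" by (simp add: algebra_simps)
    also have "\<dots> \<le> e * \<bar>?c\<bar> * norm v" using \<eta>(3) by (intro mult_right_mono) auto
    finally have "\<bar>\<Delta> * ?c + H' (v, 0)\<bar> \<le> e * \<bar>?c\<bar> * norm v" using main by simp
    moreover have "\<Delta> * ?c + H' (v, 0) = (\<Delta> + H' (v, 0) / ?c) * ?c" using c by (simp add: field_simps)
    ultimately have "\<bar>\<Delta> + H' (v, 0) / ?c\<bar> * \<bar>?c\<bar> \<le> (e * norm v) * \<bar>?c\<bar>"
      by (simp add: abs_mult mult_ac)
    then show ?case using c by (simp add: v_def \<Delta>_def)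
  qed
  then show "eventually (\<lambda>q. norm (\<tau> q - \<tau> p - (- H' (q - p, 0) / ?c)) \<le> e * norm (q - p)) (at p)"
    by (simp add: eventually_nhds_conv_at)
qed

section \<open>Partial derivatives\<close>

text \<open>The Riesz vector of \<open>f'\<close> is a gradient, and uniqueness of derivatives makes
  it the one picked by the definite description.\<close>

lemma gradient_inner:
  fixes f :: "'a::euclidean_space \<Rightarrow> real"
  assumes f: "(f has_derivative f') (at x)"
  shows "gradient f x \<bullet> v = f' v"
proof -
  interpret f': bounded_linear f' by (rule has_derivative_bounded_linear[OF f])
  define D where "D = (\<Sum>i\<in>Basis. f' i *\<^sub>R i)"
  have D: "D \<bullet> v = f' v" for v
  proof -
    have "f' v = f' (\<Sum>i\<in>Basis. (v \<bullet> i) *\<^sub>R i)" by (simp add: euclidean_representation)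
    also have "\<dots> = (\<Sum>i\<in>Basis. (v \<bullet> i) * f' i)" by (simp add: f'.sum f'.scaleR)
    finally show ?thesis
      by (simp add: D_def inner_sum_left inner_commute[of v] mult.commute)
  qed
  have "gradient f x = D"
    unfolding gradient_def
  proof (rule the_equality)
    show "GDERIV f x :> D"
      using f D by (simp add: gderiv_def inner_commute)
    show "E = D" if "GDERIV f x :> E" for E
    proof -
      have "(\<lambda>h. h \<bullet> E) = f'"
        using that f unfolding gderiv_def by (rule has_derivative_unique)
      then have "E \<bullet> v = D \<bullet> v" for v using D by (metis inner_commute)
      then show ?thesis by (metis vector_eq_rdot)
    qed
  qed
  then show ?thesis by (simp add: D)
qed

lemma has_derivative_partial_fst:
  assumes "(f has_derivative f') (at (x, t))"
  shows "((\<lambda>y. f (y, t)) has_derivative (\<lambda>v. f' (v, 0))) (at x)"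
  by (rule has_derivative_compose[where f = "\<lambda>y. (y, t)", OF _ assms])
    (auto intro!: derivative_eq_intros)

lemma has_derivative_partial_snd:
  assumes "(f has_derivative f') (at (x, t))"
  shows "((\<lambda>s. f (x, s)) has_derivative (\<lambda>s. f' (0, s))) (at t)"
  by (rule has_derivative_compose[where f = "\<lambda>s. (x, s)", OF _ assms])
    (auto intro!: derivative_eq_intros)

text \<open>For \<open>v = F x\<close> this turns both the transversality expression of
  \<open>G\<close> and the transport expression of the hitting time into one directional
  derivative.\<close>

lemma deriv_plus_gradient_inner:
  fixes f :: "'a::euclidean_space \<times> real \<Rightarrow> real"
  assumes f: "(f has_derivative f') (at (x, t))"
  shows "deriv (\<lambda>s. f (x, s)) t + gradient (\<lambda>y. f (y, t)) x \<bullet> v = f' (v, 1)"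
proof -
  interpret f': bounded_linear f' by (rule has_derivative_bounded_linear[OF f])
  have "f' (0, s) = f' (0, 1) * s" for s
    using f'.scaleR[of s "(0, 1)"] by (simp add: mult.commute)
  then have "(\<lambda>s. f' (0, s)) = (*) (f' (0, 1))"
    by blast
  then have "deriv (\<lambda>s. f (x, s)) t = f' (0, 1)"
    using has_derivative_partial_snd[OF f] by (intro DERIV_imp_deriv) (simp add: has_field_derivative_def)
  then show ?thesis
    using f'.add[of "(0, 1)" "(v, 0)"] gradient_inner[OF has_derivative_partial_fst[OF f]] by simp
qed

lemma vector_derivative_plus_jacobian:
  fixes f :: "(real ^ 'n) \<times> real \<Rightarrow> real ^ 'm"
  assumes f: "(f has_derivative f') (at (x, t))"
  shows "vector_derivative (\<lambda>s. f (x, s)) (at t) + jacobian (\<lambda>y. f (y, t)) (at x) *v v = f' (v, 1)"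
proof -
  interpret f': bounded_linear f' by (rule has_derivative_bounded_linear[OF f])
  have "f' (0, s) = s *\<^sub>R f' (0, 1)" for s
    using f'.scaleR[of s "(0, 1)"] by simp
  then have "(\<lambda>s. f' (0, s)) = (\<lambda>s. s *\<^sub>R f' (0, 1))"
    by blast
  then have "vector_derivative (\<lambda>s. f (x, s)) (at t) = f' (0, 1)"
    using has_derivative_partial_snd[OF f]
    by (intro vector_derivative_at) (simp add: has_vector_derivative_def)
  moreover have "jacobian (\<lambda>y. f (y, t)) (at x) *v v = f' (v, 0)"
  proof -
    have "((\<lambda>y. f (y, t)) has_derivative (*v) (jacobian (\<lambda>y. f (y, t)) (at x))) (at x)"
      using has_derivative_partial_fst[OF f] jacobian_works by (auto simp: differentiable_def)
    then have "(*v) (jacobian (\<lambda>y. f (y, t)) (at x)) = (\<lambda>v. f' (v, 0))"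
      using has_derivative_partial_fst[OF f] by (rule has_derivative_unique)
    then show ?thesis by metis
  qed
  ultimately show ?thesis
    using f'.add[of "(0, 1)" "(v, 0)"] by simp
qed

section \<open>Transversal hitting times\<close>

text \<open>Existence is \<open>global_flow\<close>, uniqueness comes from the \<open>C1\<close>
  hypothesis; together they make the description in \<open>flow\<close> denote a solution.\<close>

lemma global_solution_flow:
  fixes F :: "real ^ 'n \<Rightarrow> real ^ 'n"
  assumes "C1_map F" "global_flow F"
  shows "global_solution F x\<^sub>0 t\<^sub>0 (\<lambda>t. flow F t x\<^sub>0 t\<^sub>0)"
proof -
  obtain F' where F': "\<And>x. (F has_derivative blinfun_apply (F' x)) (at x)" "continuous_on UNIV F'"
    using \<open>C1_map F\<close> by (auto simp: C1_map_def)
  have "x = y" if "global_solution F x\<^sub>0 t\<^sub>0 x" "global_solution F x\<^sub>0 t\<^sub>0 y" for x y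
    using that unfolding global_solution_def
    by (intro solution_unique[OF F', where t\<^sub>0 = t\<^sub>0]) auto
  then have "global_solution F x\<^sub>0 t\<^sub>0 (THE x. global_solution F x\<^sub>0 t\<^sub>0 x)"
    using \<open>global_flow F\<close> unfolding global_flow_def by (metis theI')
  then show ?thesis by (simp add: flow_def)
qed

text \<open>Hitting times are bounded below by the initial time, so for a nonempty set the extended
  infimum is the real one.\<close>

lemma hit_time_real_eq:
  fixes F :: "real ^ 'n \<Rightarrow> real ^ 'n"
  defines "A \<equiv> \<lambda>S x\<^sub>0 t\<^sub>0. {t. t\<^sub>0 < t \<and> (flow F t x\<^sub>0 t\<^sub>0, t) \<in> S}"
  shows "hit_time F S x\<^sub>0 t\<^sub>0 < \<infinity> \<longleftrightarrow> A S x\<^sub>0 t\<^sub>0 \<noteq> {}"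
    and "A S x\<^sub>0 t\<^sub>0 \<noteq> {} \<Longrightarrow> hit_time_real F S x\<^sub>0 t\<^sub>0 = Inf (A S x\<^sub>0 t\<^sub>0)"
proof -
  have eq: "hit_time F S x\<^sub>0 t\<^sub>0 = ereal (Inf (A S x\<^sub>0 t\<^sub>0))" if "A S x\<^sub>0 t\<^sub>0 \<noteq> {}"
  proof -
    have "bdd_below (A S x\<^sub>0 t\<^sub>0)"
      by (rule bdd_belowI[of _ t\<^sub>0]) (auto simp: A_def)
    from ereal_Inf'[OF this that] show ?thesis
      by (simp add: hit_time_def A_def)
  qed
  have "hit_time F S x\<^sub>0 t\<^sub>0 = \<infinity>" if "A S x\<^sub>0 t\<^sub>0 = {}"
  proof -
    have "{t. t > t\<^sub>0 \<and> (flow F t x\<^sub>0 t\<^sub>0, t) \<in> S} = {}" using that by (simp add: A_def)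
    then show ?thesis unfolding hit_time_def by (simp only: image_empty Inf_empty top_ereal_def)
  qed
  then show "hit_time F S x\<^sub>0 t\<^sub>0 < \<infinity> \<longleftrightarrow> A S x\<^sub>0 t\<^sub>0 \<noteq> {}" using eq by fastforce
  show "hit_time_real F S x\<^sub>0 t\<^sub>0 = Inf (A S x\<^sub>0 t\<^sub>0)" if "A S x\<^sub>0 t\<^sub>0 \<noteq> {}"
    using eq[OF that] by (simp add: hit_time_real_def)
qed

locale transversal_hitting =
  fixes F :: "real ^ 'n \<Rightarrow> real ^ 'n" and G :: "(real ^ 'n) \<times> real \<Rightarrow> real"
    and F' :: "real ^ 'n \<Rightarrow> (real ^ 'n) \<Rightarrow>\<^sub>L (real ^ 'n)"
    and G' :: "(real ^ 'n) \<times> real \<Rightarrow> ((real ^ 'n) \<times> real) \<Rightarrow>\<^sub>L real"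
  assumes F': "\<And>x. (F has_derivative blinfun_apply (F' x)) (at x)" "continuous_on UNIV F'"
    and G': "\<And>z. (G has_derivative blinfun_apply (G' z)) (at z)" "continuous_on UNIV G'"
    and global: "global_flow F"
begin

lemma flow_solution:
  shows "flow F t\<^sub>0 x\<^sub>0 t\<^sub>0 = x\<^sub>0"
    and "((\<lambda>t. flow F t x\<^sub>0 t\<^sub>0) has_vector_derivative F (flow F t x\<^sub>0 t\<^sub>0)) (at t)"
proof -
  have "C1_map F" using F' by (auto simp: C1_map_def)
  from global_solution_flow[OF this global, of x\<^sub>0 t\<^sub>0]
  show "flow F t\<^sub>0 x\<^sub>0 t\<^sub>0 = x\<^sub>0"
    "((\<lambda>t. flow F t x\<^sub>0 t\<^sub>0) has_vector_derivative F (flow F t x\<^sub>0 t\<^sub>0)) (at t)"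
    by (auto simp: global_solution_def)
qed

sublocale C1_flow F F' "\<lambda>x t. flow F t x 0"
  by unfold_locales (use F' flow_solution in auto)

lemma flow_autonomous: "flow F t x\<^sub>0 t\<^sub>0 = flow F (t - t\<^sub>0) x\<^sub>0 0"
proof -
  have "((\<lambda>t. flow F (t - t\<^sub>0) x\<^sub>0 0) has_vector_derivative F (flow F (t - t\<^sub>0) x\<^sub>0 0)) (at t)" for t
    using vector_diff_chain_at[of "\<lambda>t. t - t\<^sub>0" 1 t "\<lambda>t. flow F t x\<^sub>0 0", OF _ flow_solution(2)]
      has_vector_derivative_diff[OF has_vector_derivative_id has_vector_derivative_const]
    by (simp add: o_def)
  then have "(\<lambda>t. flow F t x\<^sub>0 t\<^sub>0) = (\<lambda>t. flow F (t - t\<^sub>0) x\<^sub>0 0)"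
    by (intro solution_unique[OF F' flow_solution(2), where t\<^sub>0 = t\<^sub>0]) (auto simp: flow_solution)
  then show ?thesis by metis
qed

section \<open>The hitting problem as a parametrized zero problem\<close>

definition state :: "((real ^ 'n) \<times> real) \<times> real \<Rightarrow> real ^ 'n" where
  "state z = flow F (snd z) (fst (fst z)) (snd (fst z))"

definition H :: "((real ^ 'n) \<times> real) \<times> real \<Rightarrow> real" where
  "H z = G (state z, snd z)"

definition hits :: "(real ^ 'n) \<times> real \<Rightarrow> real set" where
  "hits q = {t. snd q < t \<and> H (q, t) = 0}"

definition \<tau> :: "(real ^ 'n) \<times> real \<Rightarrow> real" where
  "\<tau> = (\<lambda>(x\<^sub>0, t\<^sub>0). hit_time_real F (zero_set G) x\<^sub>0 t\<^sub>0)"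

text \<open>The time derivative of \<open>H\<close> along a trajectory; at a zero of
  \<open>H\<close> it is the expression tested by \<open>transversal_part\<close>.\<close>

definition speed :: "((real ^ 'n) \<times> real) \<times> real \<Rightarrow> real" where
  "speed z = G' (state z, snd z) (F (state z), 1)"

text \<open>The state depends on the two times only through their difference. Along
  \<open>((F x, 1), 0)\<close> the derivative is thus \<open>L (F x)\<close> minus the velocity at
  the end, which cancel.\<close>

lemma state_has_derivative:
  obtains S where "(state has_derivative S) (at z)"
    "S ((F (fst (fst z)), 1), 0) = 0" "S (0, 1) = F (state z)"
proof -
  obtain x s t where z: "z = ((x, s), t)" by (metis surj_pair)
  obtain L where L: "bounded_linear L" "L (F x) = F (flow F (t - s) x 0)"
    "((\<lambda>(x, t). flow F t x 0) has_derivative (\<lambda>(a, u). L a + u *\<^sub>R F (flow F (t - s) x 0))) (at (x, t - s))"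
    using flow_has_derivative by blast
  have "((\<lambda>z. (fst (fst z), snd z - snd (fst z))) has_derivative
      (\<lambda>w. (fst (fst w), snd w - snd (fst w)))) (at z)"
    by (auto intro!: derivative_eq_intros)
  from has_derivative_compose[OF this, of "\<lambda>(x, t). flow F t x 0"
      "\<lambda>(a, u). L a + u *\<^sub>R F (flow F (t - s) x 0)"] L(3)
  have "((\<lambda>z. flow F (snd z - snd (fst z)) (fst (fst z)) 0) has_derivative
      (\<lambda>w. L (fst (fst w)) + (snd w - snd (fst w)) *\<^sub>R F (flow F (t - s) x 0))) (at z)"
    by (simp add: z)
  moreover have "state = (\<lambda>z. flow F (snd z - snd (fst z)) (fst (fst z)) 0)"
    by (simp add: fun_eq_iff state_def flow_autonomous[symmetric])
  moreover have "L 0 = 0" using L(1) by (intro linear_0 bounded_linear.linear)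
  ultimately show thesis
    using that[of "\<lambda>w. L (fst (fst w)) + (snd w - snd (fst w)) *\<^sub>R F (flow F (t - s) x 0)"]
    by (simp add: z L(2))
qed

lemma continuous_on_state: "continuous_on UNIV state"
  by (metis continuous_at_imp_continuous_on has_derivative_continuous state_has_derivative)

lemma H_has_derivative:
  assumes "(state has_derivative S) (at z)"
  shows "(H has_derivative (\<lambda>w. G' (state z, snd z) (S w, snd w))) (at z)"
proof -
  have "((\<lambda>z. (state z, snd z)) has_derivative (\<lambda>w. (S w, snd w))) (at z)"
    by (intro has_derivative_Pair assms has_derivative_snd has_derivative_ident)
  from has_derivative_compose[OF this G'(1)] show ?thesis
    by (simp add: H_def[abs_def])
qed

lemma continuous_on_H: "continuous_on UNIV H"
proof -
  have "continuous_on UNIV G"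
    using has_derivative_continuous[OF G'(1)] by (intro continuous_at_imp_continuous_on) blast
  then show ?thesis
    unfolding H_def[abs_def]
    by (rule continuous_on_compose2) (auto intro!: continuous_intros continuous_on_state)
qed

lemma continuous_on_speed: "continuous_on UNIV speed"
proof -
  have "continuous_on UNIV F"
    using has_derivative_continuous[OF F'(1)] by (intro continuous_at_imp_continuous_on) blast
  then have "continuous_on UNIV (\<lambda>z. F (state z))"
    by (rule continuous_on_compose2[OF _ continuous_on_state]) simp
  moreover have "continuous_on UNIV (\<lambda>z. (state z, snd z))"
    by (intro continuous_on_Pair continuous_on_state continuous_on_snd continuous_on_id)
  then have "continuous_on UNIV (\<lambda>z. G' (state z, snd z))"
    by (rule continuous_on_compose2[OF G'(2)]) simp
  ultimately show ?thesis
    unfolding speed_def[abs_def]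
    by (intro blinfun.continuous_on continuous_on_Pair continuous_on_const)
qed

lemma H_deriv_time: "DERIV (\<lambda>t. H (q, t)) t :> speed (q, t)"
proof -
  obtain S where S: "(state has_derivative S) (at (q, t))" "S (0, 1) = F (state (q, t))"
    using state_has_derivative by blast
  interpret S: bounded_linear S by (rule has_derivative_bounded_linear[OF S(1)])
  have "G' (state (q, t), t) (S (0, s), s) = speed (q, t) * s" for s
    using S.scaleR[of s "(0, 1)"] blinfun.scaleR_right[of "G' (state (q, t), t)" s "(F (state (q, t)), 1)"]
    by (simp add: speed_def S(2) mult.commute)
  then show ?thesis
    using has_derivative_partial_snd[OF H_has_derivative[OF S(1)]]
    by (simp add: has_field_derivative_def)
qed

lemma zero_set_iff: "(state z, snd z) \<in> zero_set G \<longleftrightarrow> H z = 0"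
  by (simp add: zero_set_def H_def)

lemma \<tau>_eq: "hits q \<noteq> {} \<Longrightarrow> \<tau> q = Inf (hits q)"
  using hit_time_real_eq(2)[of "snd q" F "fst q" "zero_set G"]
  by (simp add: hits_def \<tau>_def case_prod_unfold zero_set_def H_def state_def)

lemma H_\<tau>:
  assumes "H (q, snd q) \<noteq> 0" "hits q \<noteq> {}"
  shows "H (q, \<tau> q) = 0"
proof -
  have "continuous_on UNIV (\<lambda>t. H (q, t))"
    by (rule continuous_on_compose2[OF continuous_on_H]) (auto intro!: continuous_intros)
  from first_zero_mem[OF this assms(1)] assms(2) show ?thesis
    by (simp add: \<tau>_eq hits_def)
qed

text \<open>The requirement that the hitting point lie on the surface disappears, because off the
  surface the first zero is attained. What remains is stable under perturbation.\<close>

lemma transversal_reach_set_iff: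
  "q \<in> transversal_reach_set F G \<longleftrightarrow>
     H (q, snd q) \<noteq> 0 \<and> hits q \<noteq> {} \<and> speed (q, \<tau> q) \<noteq> 0"
proof -
  have "q \<in> zero_set G \<longleftrightarrow> H (q, snd q) = 0"
    using zero_set_iff[of "(q, snd q)"] by (simp add: state_def flow_solution)
  moreover have "hit_time F (zero_set G) (fst q) (snd q) < \<infinity> \<longleftrightarrow> hits q \<noteq> {}"
    unfolding hit_time_real_eq(1) by (simp add: hits_def zero_set_def H_def state_def)
  moreover have "(hit_state F (zero_set G) (fst q) (snd q), hit_time_real F (zero_set G) (fst q) (snd q))
      = (state (q, \<tau> q), \<tau> q)"
    by (simp add: hit_state_def state_def \<tau>_def case_prod_unfold)
  moreover have "(state z, snd z) \<in> transversal_part F G \<longleftrightarrow> H z = 0 \<and> speed z \<noteq> 0" for z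
    using zero_set_iff[of z] deriv_plus_gradient_inner[OF G'(1)]
    by (simp add: transversal_part_def speed_def)
  from this[of "(q, \<tau> q)"]
  have "(state (q, \<tau> q), \<tau> q) \<in> transversal_part F G \<longleftrightarrow> H (q, \<tau> q) = 0 \<and> speed (q, \<tau> q) \<noteq> 0"
    by simp
  ultimately show ?thesis
    using H_\<tau>[of q] by (auto simp: transversal_reach_set_def case_prod_unfold)
qed

section \<open>Local behaviour at a point of the transversal set\<close>

context
  fixes p assumes p: "p \<in> transversal_reach_set F G"
begin

lemma \<tau>_perturbation:
  assumes "e > 0"
  shows "eventually (\<lambda>q. H (q, snd q) \<noteq> 0 \<and> hits q \<noteq> {} \<and> \<bar>\<tau> q - \<tau> p\<bar> < e) (nhds p)"
proof -
  have p': "H (p, snd p) \<noteq> 0" "hits p \<noteq> {}" "speed (p, \<tau> p) \<noteq> 0"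
    using p by (auto simp: transversal_reach_set_iff)
  have "eventually (\<lambda>q. hits q \<noteq> {} \<and> \<bar>Inf (hits q) - Inf (hits p)\<bar> < e) (nhds p)"
    unfolding hits_def
  proof (rule first_zero_perturbation[where \<sigma> = snd and c = "speed (p, \<tau> p)"])
    show "DERIV (\<lambda>t. H (p, t)) (Inf {t. snd p < t \<and> H (p, t) = 0}) :> speed (p, \<tau> p)"
      using H_deriv_time[of p "\<tau> p"] \<tau>_eq[OF p'(2)] by (simp add: hits_def)
    show "{t. snd p < t \<and> H (p, t) = 0} \<noteq> {}"
      using p'(2) by (simp add: hits_def)
    show "continuous_on UNIV (snd :: (real ^ 'n) \<times> real \<Rightarrow> real)"
      by (intro continuous_on_snd continuous_on_id)
  qed (fact continuous_on_H p' assms)+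
  moreover have "eventually (\<lambda>q. H (q, snd q) \<noteq> 0) (nhds p)"
  proof -
    have "open {q. H (q, snd q) \<noteq> 0}"
      by (intro open_Collect_neq continuous_on_compose2[OF continuous_on_H] continuous_intros) auto
    then show ?thesis using p'(1) by (auto simp: eventually_nhds)
  qed
  ultimately show ?thesis
    by eventually_elim (simp add: \<tau>_eq p'(2))
qed

lemma isCont_\<tau>: "isCont \<tau> p"
  unfolding isCont_def tendsto_iff dist_real_def
proof (intro allI impI)
  fix e :: real assume "e > 0"
  then have "eventually (\<lambda>q. \<bar>\<tau> q - \<tau> p\<bar> < e) (nhds p)"
    using eventually_mono[OF \<tau>_perturbation] by simp
  then show "eventually (\<lambda>q. \<bar>\<tau> q - \<tau> p\<bar> < e) (at p)"
    by (simp add: eventually_nhds_conv_at)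
qed

text \<open>\<open>speed\<close> is continuous because \<open>F\<close> and the derivative of
  \<open>G\<close> are; with \<open>\<tau>\<close> continuous at \<open>p\<close>, it stays nonzero
  at nearby hitting points.\<close>

lemma eventually_transversal: "eventually (\<lambda>q. q \<in> transversal_reach_set F G) (nhds p)"
proof -
  have "isCont speed (p, \<tau> p)"
    using continuous_on_speed continuous_on_eq_continuous_at[OF open_UNIV] by blast
  then have "((\<lambda>q. speed (q, \<tau> q)) \<longlongrightarrow> speed (p, \<tau> p)) (at p)"
    using isCont_\<tau> by (intro isCont_tendsto_compose[of _ speed]) (auto simp: isCont_def intro!: tendsto_intros)
  moreover have "speed (p, \<tau> p) \<noteq> 0" using p by (simp add: transversal_reach_set_iff)
  ultimately have "eventually (\<lambda>q. speed (q, \<tau> q) \<noteq> 0) (nhds p)"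
    using tendsto_imp_eventually_ne by (fastforce simp: eventually_nhds_conv_at)
  with \<tau>_perturbation[OF zero_less_one] show ?thesis
    by eventually_elim (simp add: transversal_reach_set_iff)
qed

text \<open>The derivative of \<open>H\<close> vanishes along \<open>((F (fst p), 1), 0)\<close>, so
  \<open>T\<close> does along \<open>(F (fst p), 1)\<close>. By the chain rule \<open>X\<close> then
  equals \<open>S ((F (fst p), 1), 0)\<close>, which is 0.\<close>

lemma hit_derivatives:
  obtains T X where "(\<tau> has_derivative T) (at p)" "T (F (fst p), 1) = 0"
    "((\<lambda>q. state (q, \<tau> q)) has_derivative X) (at p)" "X (F (fst p), 1) = 0"
proof -
  obtain S where S: "(state has_derivative S) (at (p, \<tau> p))"
    "S ((F (fst p), 1), 0) = 0" "S (0, 1) = F (state (p, \<tau> p))"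
    using state_has_derivative[of "(p, \<tau> p)"] by auto
  define H' where "H' w = G' (state (p, \<tau> p), \<tau> p) (S w, snd w)" for w
  have H': "(H has_derivative H') (at (p, \<tau> p))"
    using H_has_derivative[OF S(1)] by (simp add: H'_def[abs_def])
  have "H' (0, 1) \<noteq> 0"
    using p by (simp add: transversal_reach_set_iff H'_def S(3) speed_def)
  moreover have "eventually (\<lambda>q. H (q, \<tau> q) = 0) (nhds p)"
    using \<tau>_perturbation[OF zero_less_one] by eventually_elim (simp add: H_\<tau>)
  ultimately have T: "(\<tau> has_derivative (\<lambda>v. - H' (v, 0) / H' (0, 1))) (at p)"
    using implicit_has_derivative[OF H' _ isCont_\<tau>] by blast
  have "((\<lambda>q. (q, \<tau> q)) has_derivative (\<lambda>v. (v, - H' (v, 0) / H' (0, 1)))) (at p)"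
    by (intro has_derivative_Pair has_derivative_ident T)
  from has_derivative_compose[OF this S(1)]
  have X: "((\<lambda>q. state (q, \<tau> q)) has_derivative (\<lambda>v. S (v, - H' (v, 0) / H' (0, 1)))) (at p)" .
  have "H' ((F (fst p), 1), 0) = 0"
    by (simp add: H'_def S(2) flip: zero_prod_def)
  then show thesis
    by (intro that[OF T _ X]) (simp_all add: S(2))
qed

end

end

theorem proposition2:
  fixes F :: "real ^ 'n \<Rightarrow> real ^ 'n"
    and G :: "(real ^ 'n) \<times> real \<Rightarrow> real"
  assumes "C1_map F"
    and "global_flow F"
    and "C1_map G"
  shows "open (transversal_reach_set F G)
    \<and> (\<lambda>(x\<^sub>0, t\<^sub>0). hit_time_real F (zero_set G) x\<^sub>0 t\<^sub>0) differentiable_on transversal_reach_set F G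
    \<and> (\<lambda>(x\<^sub>0, t\<^sub>0). hit_state F (zero_set G) x\<^sub>0 t\<^sub>0) differentiable_on transversal_reach_set F G
    \<and> (\<forall>(x\<^sub>0, t\<^sub>0) \<in> transversal_reach_set F G.
          deriv (\<lambda>s. hit_time_real F (zero_set G) x\<^sub>0 s) t\<^sub>0
            + gradient (\<lambda>y. hit_time_real F (zero_set G) y t\<^sub>0) x\<^sub>0 \<bullet> F x\<^sub>0 = 0
        \<and> vector_derivative (\<lambda>s. hit_state F (zero_set G) x\<^sub>0 s) (at t\<^sub>0)
            + jacobian (\<lambda>y. hit_state F (zero_set G) y t\<^sub>0) (at x\<^sub>0) *v F x\<^sub>0 = 0)"
proof -
  obtain F' where F': "\<And>x. (F has_derivative blinfun_apply (F' x)) (at x)" "continuous_on UNIV F'"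
    using \<open>C1_map F\<close> by (auto simp: C1_map_def)
  obtain G' where G': "\<And>z. (G has_derivative blinfun_apply (G' z)) (at z)" "continuous_on UNIV G'"
    using \<open>C1_map G\<close> by (auto simp: C1_map_def)
  interpret transversal_hitting F G F' G'
    by unfold_locales (fact F' G' \<open>global_flow F\<close>)+
  let ?R = "transversal_reach_set F G"
  let ?t = "\<lambda>(x\<^sub>0, t\<^sub>0). hit_time_real F (zero_set G) x\<^sub>0 t\<^sub>0"
  let ?x = "\<lambda>(x\<^sub>0, t\<^sub>0). hit_state F (zero_set G) x\<^sub>0 t\<^sub>0"
  have state_\<tau>: "(\<lambda>q. state (q, \<tau> q)) = ?x"
    by (auto simp: state_def hit_state_def \<tau>_def)
  have D: "\<exists>T X. (?t has_derivative T) (at p) \<and> T (F (fst p), 1) = 0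
      \<and> (?x has_derivative X) (at p) \<and> X (F (fst p), 1) = 0" if p: "p \<in> ?R" for p
  proof -
    obtain T X where "(\<tau> has_derivative T) (at p)" "T (F (fst p), 1) = 0"
      "((\<lambda>q. state (q, \<tau> q)) has_derivative X) (at p)" "X (F (fst p), 1) = 0"
      by (rule hit_derivatives[OF p])
    then show ?thesis unfolding state_\<tau> unfolding \<tau>_def by blast
  qed
  have "open ?R"
  proof (subst open_subopen, rule ballI)
    fix p assume "p \<in> ?R"
    from eventually_transversal[OF this]
    show "\<exists>T. open T \<and> p \<in> T \<and> T \<subseteq> ?R"
      unfolding eventually_nhds subset_eq .
  qed
  moreover have "?t differentiable_on ?R" "?x differentiable_on ?R"
    using D unfolding differentiable_on_def differentiable_def
    by (meson has_derivative_at_withinI)+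
  moreover have "deriv (\<lambda>s. hit_time_real F (zero_set G) x\<^sub>0 s) t\<^sub>0
      + gradient (\<lambda>y. hit_time_real F (zero_set G) y t\<^sub>0) x\<^sub>0 \<bullet> F x\<^sub>0 = 0
    \<and> vector_derivative (\<lambda>s. hit_state F (zero_set G) x\<^sub>0 s) (at t\<^sub>0)
      + jacobian (\<lambda>y. hit_state F (zero_set G) y t\<^sub>0) (at x\<^sub>0) *v F x\<^sub>0 = 0"
    if p: "(x\<^sub>0, t\<^sub>0) \<in> ?R" for x\<^sub>0 t\<^sub>0
  proof -
    obtain T X where T: "(?t has_derivative T) (at (x\<^sub>0, t\<^sub>0))" "T (F x\<^sub>0, 1) = 0"
      and X: "(?x has_derivative X) (at (x\<^sub>0, t\<^sub>0))" "X (F x\<^sub>0, 1) = 0"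
      using D[OF p] by auto
    show ?thesis
      using deriv_plus_gradient_inner[OF T(1), of "F x\<^sub>0"] T(2)
        vector_derivative_plus_jacobian[OF X(1), of "F x\<^sub>0"] X(2) by simp
  qed
  ultimately show ?thesis by blast
qed

end
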